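(* Let $K$ be a field, and let $m_0<m_1<m_2<m_3$ be positive integers with $\gcd=1$, $m_i=m_0+id$ ($d>0$), minimally generating the numerical semigroup they generate. Write $m_0=3a+b$ with integers $a\ge 1$, $b\in\{1,2,3\}$, and suppose $b\in\{1,2\}$. Let $E_b\subseteq R_b$ be the kernel of the $K$-algebra homomorphism $\varphi_b:R_b\to K[X_0,X_1,X_2,X_3][t]$ given by $X_i\mapsto X_i$, $\Phi(i,j)\mapsto\phi(i,j)t$, $\Psi(b,j)\mapsto\psi(b,j)t$ (its image is the Rees algebra $R[\wp t]$ of the defining ideal $\wp$ of the monomial curve $X_i=T^{m_i}$). Then, with respect to (the restriction to $R_b$ of) the monomial order $>_{\mathcal E}$, a Gröbner basis of $E_b$ is the set consisting of all $A(i;b,j)$ ($i\in\{1,2,3\}$, $j\in[0,2-b]$), all $B(i,j)$ ($i,j\in\{1,2\}$), $D$, $L(0)$, $L(1)$, and $Q(1,1),Q(1,2)$ if $b=1$, resp. $Q(2,1)$ if $b=2$.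
   Context: $[u,v]=\{n\in\mathbb{Z}:u\le n\le v\}$. $\phi(1,1)=X_1^2-X_2X_0$, $\phi(1,2)=\phi(2,1)=X_1X_2-X_3X_0$, $\phi(2,2)=X_2^2-X_1X_3$; $\psi(b,j)=X_{b+j}X_3^a-X_jX_0^{a+d}$ for $j\in[0,3-b]$. $R_b=K[X_1,X_2,X_3,X_0,\Psi(b,0),\dots,\Psi(b,3-b),\Phi(2,2),\Phi(1,2),\Phi(1,1)]$ is a polynomial ring in these indeterminates. Conventions: $\Phi(i,j)=\Phi(j,i)$; $\Phi(i,j)=0$ if $i$ or $j\notin\{1,2\}$; $\Psi(b,j)=0$ if $j\notin[0,3-b]$; $X_i=0$ if $i\notin[0,3]$; $\epsilon(u,v)=u+v$ if $u+v<3$, $=3$ if $u+v\ge3$. Monomial order $>_{\mathcal E}$ (on $R_b[t]$, restricted to $R_b$): a monomial is $t^kX_1^{\alpha_1}X_2^{\alpha_2}X_3^{\alpha_3}X_0^{\alpha_0}\prod_{i=0}^{3-b}\Psi(b,i)^{\beta_i}\Phi(2,2)^{\gamma_1}\Phi(1,2)^{\gamma_2}\Phi(1,1)^{\gamma_3}$, $\alpha=(\alpha_1,\alpha_2,\alpha_3,\alpha_0)$, $\beta=(\beta_0,\dots,\beta_{3-b})$, $\gamma=(\gamma_1,\gamma_2,\gamma_3)$. With the additive weight $\omega(X_i)=m_i$, $\omega(\Phi(i,j))=m_i+m_j$, $\omega(\Psi(b,j))=am_3+m_{b+j}$ on $t$-free monomials, one monomial is larger than another iff the first applicable condition holds: (i)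 larger $k$; (ii) equal $k$ and larger $\omega$ of the $t$-free part; (iii) larger $\sum\beta_i$; (iv) equal $\sum\beta_i$ and rightmost nonzero entry of $\beta-\beta'$ negative; (v) $\beta=\beta'$ and larger $\sum\gamma_i$; (vi) $\beta=\beta'$, equal $\sum\gamma_i$, rightmost nonzero entry of $\gamma-\gamma'$ negative; (vii) $\beta=\beta'$, $\gamma=\gamma'$, rightmost nonzero entry of $\alpha-\alpha'$ negative. Polynomials: $D=(X_1^2-X_2X_0)\Phi(1,2)-(X_1X_2-X_3X_0)\Phi(1,1)$; $B(i,j)=\phi(i,j)\Psi(b,3-b)-(X_3^{a+1}-X_{3-b}X_0^{a+d})\Phi(i,j)$; $L(i)=X_i\Phi(2,2)-X_{i+1}\Phi(1,2)+X_{i+2}\Phi(1,1)$, $i\in\{0,1\}$; $A(i;b,j)=X_i\Psi(b,j)-X_{b+i+j-\epsilon(i,b+j)}\Psi(b,\epsilon(i,b+j)-b)-X_3^a\Phi(i,b+j)+X_0^{a+d}[\Phi(i,j)-\Phi(b+i+j-3,3-b)]$; $Q(1,1)=\Psi(1,0)\Phi(2,2)+\Psi(1,2)\Phi(1,1)-\Psi(1,1)\Phi(1,2)$; $Q(1,2)=\Psi(1,1)^2-\Psi(1,2)\Psi(1,0)-X_3^{a-1}\Psi(1,2)\Phi(2,2)+X_0^{a+d-1}\Psi(1,0)\Phi(1,1)-X_3^{a-1}X_0^{a+d-1}(\Phi(1,2)^2-\Phi(2,2)\Phi(1,1))$; $Q(2,1)=\Psi(2,0)^2\Phi(2,2)-X_3^{a-1}\Psi(2,1)\Phi(2,2)^2-\Psi(2,1)\Psi(2,0)\Phi(1,2)-X_3^{a-1}X_0^{a+d-1}\Phi(1,2)^3+\Psi(2,1)^2\Phi(1,1)+X_3^{a-1}X_0^{a+d-1}\Phi(2,2)\Phi(1,2)\Phi(1,1)+X_0^{a+d-1}\Psi(2,0)\Phi(1,1)^2$.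 *)

theory Defs
  imports "HOL-Library.Poly_Mapping"
begin

text \<open>One type of indeterminates containing the X_i, the Psi(b,j), the Phi(i,j) and t.
  Phi(i,j) with i,j in {1,2} is represented by the single variable Phi (min i j) (max i j).\<close>
datatype var = X nat | Psi nat | Phi nat nat | T

type_synonym 'k mpoly = "(var \<Rightarrow>\<^sub>0 nat) \<Rightarrow>\<^sub>0 'k"

definition Var :: "var \<Rightarrow> 'k::comm_ring_1 mpoly" where
  "Var v = Poly_Mapping.single (Poly_Mapping.single v 1) 1"

definition Const :: "'k::comm_ring_1 \<Rightarrow> 'k mpoly" where
  "Const c = Poly_Mapping.single 0 c"

definition subst :: "(var \<Rightarrow> 'k::comm_ring_1 mpoly) \<Rightarrow> 'k mpoly \<Rightarrow> 'k mpoly" where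
  "subst \<sigma> p = (\<Sum>m\<in>Poly_Mapping.keys p.
      Const (Poly_Mapping.lookup p m) * (\<Prod>v\<in>Poly_Mapping.keys m. \<sigma> v ^ Poly_Mapping.lookup m v))"

definition Xv :: "int \<Rightarrow> 'k::comm_ring_1 mpoly" where
  "Xv i = (if 0 \<le> i \<and> i \<le> 3 then Var (X (nat i)) else 0)"

definition Psiv :: "nat \<Rightarrow> int \<Rightarrow> 'k::comm_ring_1 mpoly" where
  "Psiv b j = (if 0 \<le> j \<and> j \<le> 3 - int b then Var (Psi (nat j)) else 0)"

definition Phiv :: "int \<Rightarrow> int \<Rightarrow> 'k::comm_ring_1 mpoly" where
  "Phiv i j = (if i \<in> {1,2} \<and> j \<in> {1,2} then Var (Phi (nat (min i j)) (nat (max i j))) else 0)"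

definition eps :: "int \<Rightarrow> int \<Rightarrow> int" where
  "eps u v = (if u + v < 3 then u + v else 3)"

definition vars_R :: "nat \<Rightarrow> var set" where
  "vars_R b = {X 0, X 1, X 2, X 3} \<union> {Psi j | j. j \<le> 3 - b} \<union> {Phi 2 2, Phi 1 2, Phi 1 1}"

definition R_b :: "nat \<Rightarrow> 'k::comm_ring_1 mpoly set" where
  "R_b b = {f. \<forall>m\<in>Poly_Mapping.keys f. Poly_Mapping.keys m \<subseteq> vars_R b}"

text \<open>m_i = m0 + i d; the exponent a is a parameter (m0 = 3a + b).\<close>
definition mm :: "nat \<Rightarrow> nat \<Rightarrow> nat \<Rightarrow> nat" where
  "mm m0 d i = m0 + i * d"

definition phi_small :: "int \<Rightarrow> int \<Rightarrow> 'k::comm_ring_1 mpoly" where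
  "phi_small i j =
    (if (i, j) = (1, 1) then Xv 1 ^ 2 - Xv 2 * Xv 0
     else if (i, j) = (1, 2) \<or> (i, j) = (2, 1) then Xv 1 * Xv 2 - Xv 3 * Xv 0
     else if (i, j) = (2, 2) then Xv 2 ^ 2 - Xv 1 * Xv 3
     else 0)"

definition psi_small :: "nat \<Rightarrow> nat \<Rightarrow> nat \<Rightarrow> int \<Rightarrow> 'k::comm_ring_1 mpoly" where
  "psi_small a d b j = Xv (int b + j) * Xv 3 ^ a - Xv j * Xv 0 ^ (a + d)"

definition phi_map :: "nat \<Rightarrow> nat \<Rightarrow> nat \<Rightarrow> var \<Rightarrow> 'k::comm_ring_1 mpoly" where
  "phi_map a d b v = (case v of
      X i \<Rightarrow> Var (X i)
    | Psi j \<Rightarrow> psi_small a d b (int j) * Var T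
    | Phi i j \<Rightarrow> phi_small (int i) (int j) * Var T
    | T \<Rightarrow> Var T)"

definition E_b :: "nat \<Rightarrow> nat \<Rightarrow> nat \<Rightarrow> 'k::comm_ring_1 mpoly set" where
  "E_b a d b = {f \<in> R_b b. subst (phi_map a d b) f = 0}"

definition weight :: "nat \<Rightarrow> nat \<Rightarrow> nat \<Rightarrow> nat \<Rightarrow> var \<Rightarrow> nat" where
  "weight m0 d a b v = (case v of
      X i \<Rightarrow> mm m0 d i
    | Psi j \<Rightarrow> a * mm m0 d 3 + mm m0 d (b + j)
    | Phi i j \<Rightarrow> mm m0 d i + mm m0 d j
    | T \<Rightarrow> 0)"

definition omega :: "nat \<Rightarrow> nat \<Rightarrow> nat \<Rightarrow> nat \<Rightarrow> (var \<Rightarrow>\<^sub>0 nat) \<Rightarrow> nat" where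
  "omega m0 d a b m = (\<Sum>v\<in>Poly_Mapping.keys m - {T}. weight m0 d a b v * Poly_Mapping.lookup m v)"

definition beta :: "nat \<Rightarrow> (var \<Rightarrow>\<^sub>0 nat) \<Rightarrow> int list" where
  "beta b m = map (\<lambda>j. int (Poly_Mapping.lookup m (Psi j))) [0..<4 - b]"

definition gamma :: "(var \<Rightarrow>\<^sub>0 nat) \<Rightarrow> int list" where
  "gamma m = map (\<lambda>v. int (Poly_Mapping.lookup m v)) [Phi 2 2, Phi 1 2, Phi 1 1]"

definition alpha :: "(var \<Rightarrow>\<^sub>0 nat) \<Rightarrow> int list" where
  "alpha m = map (\<lambda>v. int (Poly_Mapping.lookup m v)) [X 1, X 2, X 3, X 0]"

definition rightmost_neg :: "int list \<Rightarrow> int list \<Rightarrow> bool" where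
  "rightmost_neg xs ys = (let zs = filter (\<lambda>z. z \<noteq> 0) (map2 (-) xs ys)
                          in zs \<noteq> [] \<and> last zs < 0)"

definition gtE :: "nat \<Rightarrow> nat \<Rightarrow> nat \<Rightarrow> nat \<Rightarrow> (var \<Rightarrow>\<^sub>0 nat) \<Rightarrow> (var \<Rightarrow>\<^sub>0 nat) \<Rightarrow> bool" where
  "gtE m0 d a b m m' =
    (let k = Poly_Mapping.lookup m T; k' = Poly_Mapping.lookup m' T;
         w = omega m0 d a b m; w' = omega m0 d a b m';
         be = beta b m; be' = beta b m'; ga = gamma m; ga' = gamma m'
     in k > k'
      \<or> (k = k' \<and> w > w')
      \<or> (k = k' \<and> w = w' \<and> sum_list be > sum_list be')
      \<or> (k = k' \<and> w = w' \<and> sum_list be = sum_list be' \<and> rightmost_neg be be')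
      \<or> (k = k' \<and> w = w' \<and> be = be' \<and> sum_list ga > sum_list ga')
      \<or> (k = k' \<and> w = w' \<and> be = be' \<and> sum_list ga = sum_list ga' \<and> rightmost_neg ga ga')
      \<or> (k = k' \<and> w = w' \<and> be = be' \<and> ga = ga' \<and> rightmost_neg (alpha m) (alpha m')))"

definition lead_mon :: "((var \<Rightarrow>\<^sub>0 nat) \<Rightarrow> (var \<Rightarrow>\<^sub>0 nat) \<Rightarrow> bool) \<Rightarrow> 'k::zero mpoly \<Rightarrow> (var \<Rightarrow>\<^sub>0 nat)" where
  "lead_mon gt f = (THE m. m \<in> Poly_Mapping.keys f \<and> (\<forall>m'\<in>Poly_Mapping.keys f. m' \<noteq> m \<longrightarrow> gt m m'))"

definition mon_dvd :: "(var \<Rightarrow>\<^sub>0 nat) \<Rightarrow> (var \<Rightarrow>\<^sub>0 nat) \<Rightarrow> bool" where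
  "mon_dvd m m' = (\<forall>v. Poly_Mapping.lookup m v \<le> Poly_Mapping.lookup m' v)"

definition is_groebner_basis ::
  "((var \<Rightarrow>\<^sub>0 nat) \<Rightarrow> (var \<Rightarrow>\<^sub>0 nat) \<Rightarrow> bool) \<Rightarrow> 'k::zero mpoly set \<Rightarrow> 'k mpoly set \<Rightarrow> bool" where
  "is_groebner_basis gt G I =
    (G \<subseteq> I \<and> (\<forall>f\<in>I. f \<noteq> 0 \<longrightarrow> (\<exists>g\<in>G. g \<noteq> 0 \<and> mon_dvd (lead_mon gt g) (lead_mon gt f))))"

definition polyD :: "'k::comm_ring_1 mpoly" where
  "polyD = (Xv 1 ^ 2 - Xv 2 * Xv 0) * Phiv 1 2 - (Xv 1 * Xv 2 - Xv 3 * Xv 0) * Phiv 1 1"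

definition polyB :: "nat \<Rightarrow> nat \<Rightarrow> nat \<Rightarrow> int \<Rightarrow> int \<Rightarrow> 'k::comm_ring_1 mpoly" where
  "polyB a d b i j = phi_small i j * Psiv b (3 - int b)
      - (Xv 3 ^ (a + 1) - Xv (3 - int b) * Xv 0 ^ (a + d)) * Phiv i j"

definition polyL :: "int \<Rightarrow> 'k::comm_ring_1 mpoly" where
  "polyL i = Xv i * Phiv 2 2 - Xv (i + 1) * Phiv 1 2 + Xv (i + 2) * Phiv 1 1"

definition polyA :: "nat \<Rightarrow> nat \<Rightarrow> int \<Rightarrow> nat \<Rightarrow> int \<Rightarrow> 'k::comm_ring_1 mpoly" where
  "polyA a d i b j =
     Xv i * Psiv b j
     - Xv (int b + i + j - eps i (int b + j)) * Psiv b (eps i (int b + j) - int b)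
     - Xv 3 ^ a * Phiv i (int b + j)
     + Xv 0 ^ (a + d) * (Phiv i j - Phiv (int b + i + j - 3) (3 - int b))"

definition polyQ11 :: "'k::comm_ring_1 mpoly" where
  "polyQ11 = Psiv 1 0 * Phiv 2 2 + Psiv 1 2 * Phiv 1 1 - Psiv 1 1 * Phiv 1 2"

definition polyQ12 :: "nat \<Rightarrow> nat \<Rightarrow> 'k::comm_ring_1 mpoly" where
  "polyQ12 a d = Psiv 1 1 ^ 2 - Psiv 1 2 * Psiv 1 0
     - Xv 3 ^ (a - 1) * Psiv 1 2 * Phiv 2 2
     + Xv 0 ^ (a + d - 1) * Psiv 1 0 * Phiv 1 1
     - Xv 3 ^ (a - 1) * Xv 0 ^ (a + d - 1) * (Phiv 1 2 ^ 2 - Phiv 2 2 * Phiv 1 1)"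

definition polyQ21 :: "nat \<Rightarrow> nat \<Rightarrow> 'k::comm_ring_1 mpoly" where
  "polyQ21 a d = Psiv 2 0 ^ 2 * Phiv 2 2
     - Xv 3 ^ (a - 1) * Psiv 2 1 * Phiv 2 2 ^ 2
     - Psiv 2 1 * Psiv 2 0 * Phiv 1 2
     - Xv 3 ^ (a - 1) * Xv 0 ^ (a + d - 1) * Phiv 1 2 ^ 3
     + Psiv 2 1 ^ 2 * Phiv 1 1
     + Xv 3 ^ (a - 1) * Xv 0 ^ (a + d - 1) * Phiv 2 2 * Phiv 1 2 * Phiv 1 1
     + Xv 0 ^ (a + d - 1) * Psiv 2 0 * Phiv 1 1 ^ 2"

definition GB :: "nat \<Rightarrow> nat \<Rightarrow> nat \<Rightarrow> 'k::comm_ring_1 mpoly set" where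
  "GB a d b =
     {polyA a d i b j | i j. i \<in> {1,2,3} \<and> 0 \<le> j \<and> j \<le> 2 - int b}
   \<union> {polyB a d b i j | i j. i \<in> {1,2} \<and> j \<in> {1,2}}
   \<union> {polyD, polyL 0, polyL 1}
   \<union> (if b = 1 then {polyQ11, polyQ12 a d} else {polyQ21 a d})"

definition minimally_generating :: "(nat \<Rightarrow> nat) \<Rightarrow> bool" where
  "minimally_generating m =
    (\<forall>i\<le>3. \<not> (\<exists>c::nat \<Rightarrow> nat. c i = 0 \<and> m i = (\<Sum>j\<le>3. c j * m j)))"

end

theory Submission
  imports Defs "HOL-Computational_Algebra.Polynomial"
begin

text \<open>It suffices that the monomials divisible by no leading monomial of the proposed basis have
  linearly independent images in the Rees algebra. This is read off from leading monomials of the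
  images, in two steps. In coordinates \<open>x, v, y, z\<close> adapted to the twisted cubic cone, order by lowest
  \<open>(y, z)\<close>-degree: \<open>\<Phi>(1,1), \<Phi>(1,2), \<Phi>(2,2)\<close> lead with \<open>x z, x y, x v\<^sup>2 z\<close> and \<open>\<Psi>(b,j)\<close> with
  \<open>x\<^bsup>a+d+1\<^esup> v\<^sup>j\<close>, which separates the standard monomials containing some \<open>\<Psi>(b,j)\<close> from each other and
  from all others. For the \<open>\<Psi>\<close>-free ones, the lexicographic order \<open>X\<^sub>3 > X\<^sub>1 > X\<^sub>0 > X\<^sub>2\<close> works, with
  leading terms \<open>X\<^sub>1\<^sup>2, X\<^sub>0 X\<^sub>3, X\<^sub>1 X\<^sub>3\<close> of the \<open>\<phi>(i,j)\<close>.\<close>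

subsection \<open>Substitution\<close>

text \<open>Independence suffices because a kernel element whose leading monomial \<open>e\<close>
  were standard could have its other terms divided down to standard monomials below
  \<open>e\<close>, leaving a nonzero standard combination in the kernel. So no S-polynomial is
  computed, and the orders on the images need neither be related to >_E nor be well-orders. Two
  orders are used because each fails where the other works. In the adapted coordinates the standard
  monomials X_1^2 and X_0 X_2 both lead with x^2 v^2; a factor Psi(b,j) cures this, since the
  leading monomials of A and B then reduce the X-part to a normal form on the cone.
  Lexicographically, for b = 1, the standard monomials X_0 Psi(1,0) and X_1 X_3^(a-1) Phi(1,2) both
  lead with X_0 X_1 X_3^a t. The coordinates come from setting X_0 = x, X_1 = x v and solving
  phi(1,1) = x z for X_2, then phi(1,2) = x y for X_3.\<close>

lemma sum_single_lookup:
  "(\<Sum>m\<in>Poly_Mapping.keys p. Poly_Mapping.single m (Poly_Mapping.lookup p m)) = p"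
  by (rule poly_mapping_eqI)
     (auto simp: lookup_sum lookup_single when_def sum.delta' in_keys_iff)

lemma lookup_Const_mult: "Poly_Mapping.lookup (Const c * p) m = c * Poly_Mapping.lookup p m"
  by (simp add: Const_def mult_map_scale_conv_mult [symmetric] Poly_Mapping.map.rep_eq when_def)

lemma Const_0 [simp]: "Const 0 = 0"
  and Const_1 [simp]: "Const 1 = 1"
  by (simp_all add: Const_def)

lemma Const_add: "Const (c + d) = Const c + Const d"
  and Const_mult: "Const (c * d) = Const c * Const d"
  by (simp_all add: Const_def single_add mult_single)

definition ev_mon :: "(var \<Rightarrow> 'k::comm_ring_1 mpoly) \<Rightarrow> (var \<Rightarrow>\<^sub>0 nat) \<Rightarrow> 'k mpoly" where
  "ev_mon \<sigma> m = (\<Prod>v\<in>Poly_Mapping.keys m. \<sigma> v ^ Poly_Mapping.lookup m v)"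

lemma ev_mon_superset:
  assumes "finite S" "Poly_Mapping.keys m \<subseteq> S"
  shows "ev_mon \<sigma> m = (\<Prod>v\<in>S. \<sigma> v ^ Poly_Mapping.lookup m v)"
  unfolding ev_mon_def using assms
  by (intro prod.mono_neutral_left) (auto simp: in_keys_iff)

lemma ev_mon_add: "ev_mon \<sigma> (m + n) = ev_mon \<sigma> m * ev_mon \<sigma> n"
proof -
  let ?S = "Poly_Mapping.keys m \<union> Poly_Mapping.keys n"
  have "Poly_Mapping.keys (m + n) \<subseteq> ?S" by (rule Poly_Mapping.keys_add)
  then show ?thesis
    by (simp add: ev_mon_superset [of ?S] lookup_add power_add prod.distrib)
qed

lemma ev_mon_0 [simp]: "ev_mon \<sigma> 0 = 1"
  by (simp add: ev_mon_def)

lemma subst_superset: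
  assumes "finite S" "Poly_Mapping.keys p \<subseteq> S"
  shows "subst \<sigma> p = (\<Sum>m\<in>S. Const (Poly_Mapping.lookup p m) * ev_mon \<sigma> m)"
  unfolding subst_def ev_mon_def [symmetric] using assms
  by (intro sum.mono_neutral_left) (auto simp: in_keys_iff)

lemma subst_eq: "subst \<sigma> p = (\<Sum>m\<in>Poly_Mapping.keys p. Const (Poly_Mapping.lookup p m) * ev_mon \<sigma> m)"
  by (simp add: subst_superset)

lemma subst_single: "subst \<sigma> (Poly_Mapping.single m c) = Const c * ev_mon \<sigma> m"
  by (subst subst_superset [of "{m}"]) auto

lemma subst_0 [simp]: "subst \<sigma> 0 = 0"
  and subst_1 [simp]: "subst \<sigma> 1 = 1"
  and subst_Var [simp]: "subst \<sigma> (Var v) = \<sigma> v"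
  and subst_Const [simp]: "subst \<sigma> (Const c) = Const c"
  using subst_single [of \<sigma> 0 1] subst_single [of \<sigma> 0 c]
  by (simp_all add: subst_single ev_mon_def Var_def Const_def subst_def)

lemma subst_add: "subst \<sigma> (p + q) = subst \<sigma> p + subst \<sigma> q"
proof -
  let ?S = "Poly_Mapping.keys p \<union> Poly_Mapping.keys q"
  have "Poly_Mapping.keys (p + q) \<subseteq> ?S" by (rule Poly_Mapping.keys_add)
  then show ?thesis
    by (simp add: subst_superset [of ?S] lookup_add Const_add distrib_right sum.distrib)
qed

lemma subst_uminus: "subst \<sigma> (- p) = - subst \<sigma> p"
  using subst_add [of \<sigma> "- p" p] by (simp add: eq_neg_iff_add_eq_0)

lemma subst_diff: "subst \<sigma> (p - q) = subst \<sigma> p - subst \<sigma> q"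
  using subst_add [of \<sigma> p "- q"] by (simp add: subst_uminus)

lemma subst_sum: "subst \<sigma> (sum f A) = (\<Sum>x\<in>A. subst \<sigma> (f x))"
  by (induction A rule: infinite_finite_induct) (auto simp: subst_add)

lemma subst_mult: "subst \<sigma> (p * q) = subst \<sigma> p * subst \<sigma> q"
proof -
  let ?s = "\<lambda>p m. Poly_Mapping.single m (Poly_Mapping.lookup p m)"
  have "subst \<sigma> (p * q) = subst \<sigma> ((\<Sum>m\<in>Poly_Mapping.keys p. ?s p m) * (\<Sum>n\<in>Poly_Mapping.keys q. ?s q n))"
    by (simp add: sum_single_lookup)
  also have "\<dots> = (\<Sum>m\<in>Poly_Mapping.keys p. \<Sum>n\<in>Poly_Mapping.keys q. subst \<sigma> (?s p m * ?s q n))"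
    by (simp add: sum_product subst_sum)
  also have "\<dots> = (\<Sum>m\<in>Poly_Mapping.keys p. \<Sum>n\<in>Poly_Mapping.keys q. subst \<sigma> (?s p m) * subst \<sigma> (?s q n))"
    by (simp add: mult_single subst_single ev_mon_add Const_mult mult_ac)
  also have "\<dots> = subst \<sigma> (\<Sum>m\<in>Poly_Mapping.keys p. ?s p m) * subst \<sigma> (\<Sum>n\<in>Poly_Mapping.keys q. ?s q n)"
    by (simp add: sum_product subst_sum)
  finally show ?thesis by (simp add: sum_single_lookup)
qed

lemma subst_power: "subst \<sigma> (p ^ n) = subst \<sigma> p ^ n"
  by (induction n) (auto simp: subst_mult)

lemma subst_prod: "subst \<sigma> (prod f A) = (\<Prod>x\<in>A. subst \<sigma> (f x))"
  by (induction A rule: infinite_finite_induct) (auto simp: subst_mult)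

lemma subst_ev_mon: "subst \<tau> (ev_mon \<sigma> m) = ev_mon (\<lambda>v. subst \<tau> (\<sigma> v)) m"
  by (simp add: ev_mon_def subst_prod subst_power)

lemma subst_subst: "subst \<tau> (subst \<sigma> p) = subst (\<lambda>v. subst \<tau> (\<sigma> v)) p"
  by (simp add: subst_eq [of \<sigma>] subst_eq [of _ p] subst_sum subst_mult subst_ev_mon)

lemmas subst_simps = subst_add subst_diff subst_uminus subst_mult subst_power

subsection \<open>Monomial orders given by integer weights\<close>

text \<open>Integer polynomials are ordered lexicographically from the top coefficient downwards, so
  a list of weights, least significant first, defines a translation-invariant preorder.\<close>

definition wt :: "(var \<Rightarrow> int) \<Rightarrow> (var \<Rightarrow>\<^sub>0 nat) \<Rightarrow> int" where
  "wt w m = (\<Sum>v\<in>Poly_Mapping.keys m. w v * int (Poly_Mapping.lookup m v))"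

definition code :: "(var \<Rightarrow> int) list \<Rightarrow> (var \<Rightarrow>\<^sub>0 nat) \<Rightarrow> int poly" where
  "code ws m = Poly (map (\<lambda>w. wt w m) ws)"

definition vcode :: "(var \<Rightarrow> int) list \<Rightarrow> var \<Rightarrow> int poly" where
  "vcode ws v = Poly (map (\<lambda>w. w v) ws)"

lemma wt_superset:
  assumes "finite S" "Poly_Mapping.keys m \<subseteq> S"
  shows "wt w m = (\<Sum>v\<in>S. w v * int (Poly_Mapping.lookup m v))"
  unfolding wt_def using assms
  by (intro sum.mono_neutral_left) (auto simp: in_keys_iff)

lemma wt_add: "wt w (m + n) = wt w m + wt w n"
proof -
  let ?S = "Poly_Mapping.keys m \<union> Poly_Mapping.keys n"
  have "Poly_Mapping.keys (m + n) \<subseteq> ?S" by (rule Poly_Mapping.keys_add)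
  then show ?thesis
    by (simp add: wt_superset [of ?S] lookup_add distrib_left sum.distrib)
qed

lemma wt_0 [simp]: "wt w 0 = 0"
  by (simp add: wt_def)

lemma wt_single [simp]: "wt w (Poly_Mapping.single v n) = w v * int n"
  by (simp add: wt_def)

lemma code_add: "code ws (m + n) = code ws m + code ws n"
  by (induction ws) (auto simp: code_def wt_add)

lemma code_0 [simp]: "code ws 0 = 0"
  by (induction ws) (auto simp: code_def)

lemma code_single: "code ws (Poly_Mapping.single v n) = of_nat n * vcode ws v"
  by (induction ws) (auto simp: code_def vcode_def of_nat_poly)

lemma less_pCons_iff: "pCons a p < pCons b q \<longleftrightarrow> p < q \<or> (p = q \<and> a < b)"
  for p q :: "int poly"
  by (auto simp: less_poly_def pos_poly_pCons)

lemma code_eq_sum: "code ws m = (\<Sum>v\<in>Poly_Mapping.keys m. of_nat (Poly_Mapping.lookup m v) * vcode ws v)"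
proof (induction ws)
  case (Cons w ws)
  have "(\<Sum>v\<in>A. of_nat (f v) * pCons (w v) (g v)) =
      pCons (\<Sum>v\<in>A. w v * int (f v)) (\<Sum>v\<in>A. of_nat (f v) * g v)" for A and f :: "var \<Rightarrow> nat" and g :: "var \<Rightarrow> int poly"
    by (induction A rule: infinite_finite_induct) (auto simp: of_nat_poly)
  then show ?case using Cons by (simp add: code_def vcode_def wt_def)
qed (simp add: code_def vcode_def)

section \<open>Leading monomials and their codes under products and sums\<close>

definition is_lead :: "(var \<Rightarrow> int) list \<Rightarrow> 'k::zero mpoly \<Rightarrow> (var \<Rightarrow>\<^sub>0 nat) \<Rightarrow> bool" where
  "is_lead ws p e \<longleftrightarrow> Poly_Mapping.lookup p e \<noteq> 0 \<and>
     (\<forall>n\<in>Poly_Mapping.keys p. n \<noteq> e \<longrightarrow> code ws n < code ws e)"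

definition below :: "(var \<Rightarrow> int) list \<Rightarrow> int poly \<Rightarrow> 'k::zero mpoly \<Rightarrow> bool" where
  "below ws c p \<longleftrightarrow> (\<forall>n\<in>Poly_Mapping.keys p. code ws n < c)"

lemma below_0 [simp]: "below ws c 0"
  by (simp add: below_def)

lemma below_add: "below ws c p \<Longrightarrow> below ws c q \<Longrightarrow> below ws c (p + q)"
  for p q :: "'k::comm_ring_1 mpoly"
  using Poly_Mapping.keys_add [of p q] by (auto simp: below_def)

lemma below_uminus: "below ws c p \<Longrightarrow> below ws c (- p)"
  for p :: "'k::comm_ring_1 mpoly"
  by (auto simp: below_def in_keys_iff)

lemma below_diff: "below ws c p \<Longrightarrow> below ws c q \<Longrightarrow> below ws c (p - q)"
  for p q :: "'k::comm_ring_1 mpoly"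
  using below_add [of ws c p "- q"] by (simp add: below_uminus)

lemma below_single: "k = 0 \<or> code ws e < c \<Longrightarrow> below ws c (Poly_Mapping.single e k)"
  by (auto simp: below_def)

lemma below_mult: "below ws c p \<Longrightarrow> below ws d q \<Longrightarrow> below ws (c + d) (p * q)"
  for p q :: "'k::comm_ring_1 mpoly"
  using Poly_Mapping.keys_mult [of p q] unfolding below_def
  by (force simp: code_add intro: add_strict_mono)

lemma below_single_mult:
  "below ws d q \<Longrightarrow> below ws (code ws e + d) (Poly_Mapping.single e k * q)"
  for q :: "'k::comm_ring_1 mpoly"
  using Poly_Mapping.keys_mult [of "Poly_Mapping.single e k" q] unfolding below_def
  by (force simp: code_add split: if_splits)

lemma is_leadI:
  fixes r :: "'k::comm_ring_1 mpoly"
  assumes "k \<noteq> 0" "below ws (code ws e) r"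
  shows "is_lead ws (Poly_Mapping.single e k + r) e"
proof -
  have "Poly_Mapping.lookup r e = 0"
    using assms(2) by (auto simp: below_def in_keys_iff)
  then show ?thesis
    using assms Poly_Mapping.keys_add [of "Poly_Mapping.single e k" r]
    by (auto simp: is_lead_def lookup_add below_def)
qed

lemma is_leadE:
  fixes p :: "'k::comm_ring_1 mpoly"
  assumes "is_lead ws p e"
  obtains k r where "p = Poly_Mapping.single e k + r" "k \<noteq> 0" "below ws (code ws e) r"
proof
  let ?k = "Poly_Mapping.lookup p e"
  let ?r = "p - Poly_Mapping.single e ?k"
  show "p = Poly_Mapping.single e ?k + ?r" by simp
  show "?k \<noteq> 0" using assms by (simp add: is_lead_def)
  have "n \<in> Poly_Mapping.keys p \<and> n \<noteq> e" if "n \<in> Poly_Mapping.keys ?r" for n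
    using that by (auto simp: in_keys_iff lookup_minus lookup_single when_def split: if_splits)
  then show "below ws (code ws e) ?r"
    using assms by (auto simp: below_def is_lead_def)
qed

lemma is_lead_mult:
  fixes p q :: "'k::idom mpoly"
  assumes "is_lead ws p e" "is_lead ws q f"
  shows "is_lead ws (p * q) (e + f)"
proof -
  obtain k r where p: "p = Poly_Mapping.single e k + r" "k \<noteq> 0" "below ws (code ws e) r"
    using assms(1) by (rule is_leadE)
  obtain l s where q: "q = Poly_Mapping.single f l + s" "l \<noteq> 0" "below ws (code ws f) s"
    using assms(2) by (rule is_leadE)
  let ?t = "Poly_Mapping.single e k * s + Poly_Mapping.single f l * r + r * s"
  have "p * q = Poly_Mapping.single (e + f) (k * l) + ?t"
    by (simp add: p q algebra_simps mult_single)
  moreover have "below ws (code ws (e + f)) ?t"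
    using p q below_single_mult [of ws "code ws e" r f l]
    by (simp add: code_add below_add below_mult below_single_mult add.commute)
  ultimately show ?thesis using p q by (simp add: is_leadI)
qed

text \<open>A code need not separate monomials (\<open>ws_lex\<close> ignores \<open>Psi\<close> and
  \<open>Phi\<close>), but strict dominance in \<open>is_lead\<close> still makes the leading
  monomial unique. Keeping only its code turns products into sums in
  \<open>int poly\<close>.\<close>

definition has_lead :: "(var \<Rightarrow> int) list \<Rightarrow> 'k::zero mpoly \<Rightarrow> int poly \<Rightarrow> bool" where
  "has_lead ws p c \<longleftrightarrow> (\<exists>e. is_lead ws p e \<and> code ws e = c)"

lemma has_lead_1: "has_lead ws (1 :: 'k::idom mpoly) 0"
  unfolding has_lead_def is_lead_def by (intro exI [of _ 0]) auto

lemma has_lead_mult: "has_lead ws p c \<Longrightarrow> has_lead ws q d \<Longrightarrow> has_lead ws (p * q) (c + d)"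
  for p q :: "'k::idom mpoly"
  unfolding has_lead_def by (metis is_lead_mult code_add)

lemma has_lead_power: "has_lead ws p c \<Longrightarrow> has_lead ws (p ^ n) (of_nat n * c)"
  for p :: "'k::idom mpoly"
  by (induction n) (auto simp: has_lead_1 distrib_right intro!: has_lead_mult)

lemma has_lead_prod:
  fixes p :: "'a \<Rightarrow> 'k::idom mpoly"
  assumes "\<And>x. x \<in> A \<Longrightarrow> has_lead ws (p x) (c x)"
  shows "has_lead ws (prod p A) (sum c A)"
  using assms by (induction A rule: infinite_finite_induct) (auto simp: has_lead_1 intro!: has_lead_mult)

text \<open>The weights \<open>us\<close> live on the source: they tabulate, variable by variable,
  the code of the leading monomial of the image. Comparing images of monomials thus becomes linear
  arithmetic in the exponents of \<open>m\<close>.\<close>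

lemma has_lead_ev_mon:
  fixes \<chi> :: "var \<Rightarrow> 'k::idom mpoly"
  assumes "\<And>v. v \<in> Poly_Mapping.keys m \<Longrightarrow> has_lead ws (\<chi> v) (vcode us v)"
  shows "has_lead ws (ev_mon \<chi> m) (code us m)"
  unfolding ev_mon_def code_eq_sum using assms by (intro has_lead_prod has_lead_power)

lemma has_lead_single: "k \<noteq> 0 \<Longrightarrow> has_lead ws (Poly_Mapping.single e k) (code ws e)"
  for k :: "'k::idom"
  unfolding has_lead_def using is_leadI [of k ws e 0] by auto

lemma has_lead_below: "has_lead ws p c \<Longrightarrow> c < d \<Longrightarrow> below ws d p"
  unfolding has_lead_def is_lead_def below_def by fastforce

lemma has_lead_add: "has_lead ws p c \<Longrightarrow> below ws c q \<Longrightarrow> has_lead ws (p + q) c"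
  for p q :: "'k::comm_ring_1 mpoly"
  unfolding has_lead_def by (metis (no_types, lifting) add.assoc below_add is_leadE is_leadI)

lemma has_lead_uminus: "has_lead ws p c \<Longrightarrow> has_lead ws (- p) c"
  for p :: "'k::comm_ring_1 mpoly"
  unfolding has_lead_def is_lead_def by (simp add: in_keys_iff)

text \<open>The leading monomial of \<open>P m0\<close> cannot cancel, since every other summand
  lies entirely below its code. Ties among the other codes are harmless.\<close>

lemma sum_nonzero_of_lead:
  fixes P :: "'a \<Rightarrow> 'k::idom mpoly"
  assumes "finite M" "m0 \<in> M" "a m0 \<noteq> 0"
    and lead: "\<And>m. m \<in> M \<Longrightarrow> has_lead ws (P m) (C m)"
    and max: "\<And>m. m \<in> M \<Longrightarrow> m \<noteq> m0 \<Longrightarrow> C m < C m0"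
  shows "(\<Sum>m\<in>M. Const (a m) * P m) \<noteq> 0"
proof -
  obtain e where e: "is_lead ws (P m0) e" "code ws e = C m0"
    using lead [OF assms(2)] by (auto simp: has_lead_def)
  have "Poly_Mapping.lookup (P m) e = 0" if "m \<in> M" "m \<noteq> m0" for m
  proof (rule ccontr)
    assume "Poly_Mapping.lookup (P m) e \<noteq> 0"
    then have "e \<in> Poly_Mapping.keys (P m)" by (simp add: in_keys_iff)
    moreover have "below ws (C m0) (P m)"
      using lead max that has_lead_below by blast
    ultimately show False using e by (auto simp: below_def)
  qed
  then have "Poly_Mapping.lookup (\<Sum>m\<in>M. Const (a m) * P m) e
      = (\<Sum>m\<in>M. if m = m0 then a m0 * Poly_Mapping.lookup (P m0) e else 0)"
    unfolding lookup_sum lookup_Const_mult by (intro sum.cong) auto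
  also have "\<dots> = a m0 * Poly_Mapping.lookup (P m0) e"
    using assms(1,2) by simp
  also have "\<dots> \<noteq> 0" using assms(3) e(1) by (simp add: is_lead_def)
  finally show ?thesis by auto
qed

subsection \<open>A criterion for Groebner bases of kernels\<close>

lemma Const_uminus: "Const (- c) = - Const c"
  by (simp add: Const_def single_uminus)

lemma is_lead_exists:
  fixes f :: "'k::comm_ring_1 mpoly"
  assumes "f \<noteq> 0" and inj: "inj_on (code ws) (Poly_Mapping.keys f)"
  obtains e where "is_lead ws f e"
proof -
  let ?C = "code ws ` Poly_Mapping.keys f"
  have "?C \<noteq> {}" using assms(1) by (metis empty_is_image finite_keys sum_single_lookup sum.empty)
  then have "Max ?C \<in> ?C" by (intro Max_in) auto
  then obtain e where e: "e \<in> Poly_Mapping.keys f" "code ws e = Max ?C" by auto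
  have "code ws n < code ws e" if "n \<in> Poly_Mapping.keys f" "n \<noteq> e" for n
    using that e inj Max_ge [of ?C "code ws n"] by (force simp: inj_on_def less_le)
  then have "is_lead ws f e"
    using e by (auto simp: is_lead_def in_keys_iff)
  then show thesis by (rule that)
qed

text \<open>Phrased with the relation \<open>is_lead\<close> to avoid the description operator in
  \<open>lead_mon\<close>; \<open>lead_mon_eq\<close> reconciles the two for >_E.\<close>

definition standard :: "(var \<Rightarrow> int) list \<Rightarrow> 'k::zero mpoly set \<Rightarrow> (var \<Rightarrow>\<^sub>0 nat) \<Rightarrow> bool" where
  "standard ws G m \<longleftrightarrow> (\<forall>g\<in>G. \<forall>e. is_lead ws g e \<longrightarrow> \<not> mon_dvd e m)"

lemma mon_dvd_imp_add:
  assumes "mon_dvd e m"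
  obtains n where "m = n + e"
proof
  show "m = (m - e) + e"
    using assms by (intro poly_mapping_eqI) (auto simp: mon_dvd_def lookup_add lookup_minus)
qed

text \<open>Linear extension of a rewriting from monomials to polynomials: a property of monomials
  survives sums, because the support of a sum lies in the union of the supports.\<close>

lemma subst_replace_monomials:
  fixes p :: "'k::comm_ring_1 mpoly"
  assumes "\<And>n. n \<in> Poly_Mapping.keys p \<Longrightarrow>
      \<exists>r. (\<forall>j\<in>Poly_Mapping.keys r. Q j) \<and> subst \<chi> r = ev_mon \<chi> n"
  shows "\<exists>r. (\<forall>j\<in>Poly_Mapping.keys r. Q j) \<and> subst \<chi> r = subst \<chi> p"
proof -
  obtain R where R: "\<And>n. n \<in> Poly_Mapping.keys p \<Longrightarrow>
      (\<forall>j\<in>Poly_Mapping.keys (R n). Q j) \<and> subst \<chi> (R n) = ev_mon \<chi> n"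
    using assms by metis
  let ?r = "\<Sum>n\<in>Poly_Mapping.keys p. Const (Poly_Mapping.lookup p n) * R n"
  have "Q j" if "j \<in> Poly_Mapping.keys ?r" for j
  proof -
    obtain n where "n \<in> Poly_Mapping.keys p" "Poly_Mapping.lookup (R n) j \<noteq> 0"
    proof (rule ccontr)
      assume "\<not> thesis"
      then have "\<forall>n\<in>Poly_Mapping.keys p. Poly_Mapping.lookup (R n) j = 0"
        using that by blast
      then have "Poly_Mapping.lookup ?r j = 0"
        by (simp add: lookup_sum lookup_Const_mult)
      then show False using \<open>j \<in> _\<close> by (simp add: in_keys_iff)
    qed
    then show ?thesis using R by (auto simp: in_keys_iff)
  qed
  moreover have "subst \<chi> ?r = subst \<chi> p"
    by (simp add: subst_sum subst_mult R subst_eq [of \<chi> p])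
  ultimately show ?thesis by blast
qed

text \<open>Division by \<open>G\<close>, carried out on images under the substitution.\<close>

lemma straighten:
  fixes G :: "'k::field mpoly set"
  assumes G: "\<And>g. g \<in> G \<Longrightarrow> subst \<chi> g = 0"
      "\<And>g n. g \<in> G \<Longrightarrow> n \<in> Poly_Mapping.keys g \<Longrightarrow> Poly_Mapping.keys n \<subseteq> V"
    and fin: "\<And>m. Poly_Mapping.keys m \<subseteq> V \<Longrightarrow>
      finite {n. Poly_Mapping.keys n \<subseteq> V \<and> code ws n < code ws m}"
    and "Poly_Mapping.keys m \<subseteq> V"
  shows "\<exists>r. (\<forall>j\<in>Poly_Mapping.keys r. Poly_Mapping.keys j \<subseteq> V \<and> standard ws G j \<and> code ws j \<le> code ws m)
      \<and> subst \<chi> r = ev_mon \<chi> m"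
  using assms(4)
\<comment> \<open>Induction on the number of smaller monomials, finite by \<open>fin\<close>; the
  order on \<open>int poly\<close> itself is not well-founded.\<close>
proof (induction "card {n. Poly_Mapping.keys n \<subseteq> V \<and> code ws n < code ws m}" arbitrary: m rule: less_induct)
  case less
  show ?case
  proof (cases "standard ws G m")
    case True
    then show ?thesis using less.prems
      by (intro exI [of _ "Poly_Mapping.single m 1"]) (auto simp: subst_single)
  next
    case False
    then obtain g e where g: "g \<in> G" "is_lead ws g e" "mon_dvd e m"
      by (auto simp: standard_def)
    obtain n where n: "m = n + e" using g(3) by (rule mon_dvd_imp_add)
    obtain k q where q: "g = Poly_Mapping.single e k + q" "k \<noteq> 0" "below ws (code ws e) q"
      using g(2) by (rule is_leadE)
    \<comment> \<open>\<open>p\<close> is the monomial \<open>m\<close> minus the multiple of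
      \<open>g\<close> that cancels it: the images agree because \<open>g\<close> maps to 0, and
      everything left lies below \<open>m\<close>.\<close>
    define p where "p = Poly_Mapping.single n (- inverse k) * q"
    have "subst \<chi> q = - (Const k * ev_mon \<chi> e)"
      using G(1) [OF g(1)] by (simp add: q subst_add subst_single eq_neg_iff_add_eq_0 add.commute)
    then have "subst \<chi> p = (Const (inverse k) * Const k) * ev_mon \<chi> m"
      by (simp add: p_def n subst_mult subst_single ev_mon_add Const_uminus mult_ac)
    then have p: "subst \<chi> p = ev_mon \<chi> m"
      using q(2) by (simp flip: Const_mult)
    have keys_q: "Poly_Mapping.keys j \<subseteq> V" if "j \<in> Poly_Mapping.keys q" for j
    proof -
      have "j \<noteq> e" using that q(3) by (auto simp: below_def)
      then have "j \<in> Poly_Mapping.keys g"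
        using that by (simp add: q(1) in_keys_iff lookup_add lookup_single)
      then show ?thesis using G(2) g(1) by blast
    qed
    have keys_n: "Poly_Mapping.keys n \<subseteq> V"
      using less.prems by (auto simp: n in_keys_iff lookup_add subset_iff)
    have "below ws (code ws m) p"
      unfolding p_def n code_add by (intro below_single_mult q(3))
    moreover have "Poly_Mapping.keys j \<subseteq> V" if j: "j \<in> Poly_Mapping.keys p" for j
    proof -
      obtain i j' where "i \<in> Poly_Mapping.keys (Poly_Mapping.single n (- inverse k))"
          "j' \<in> Poly_Mapping.keys q" "j = i + j'"
        using j Poly_Mapping.keys_mult [of "Poly_Mapping.single n (- inverse k)" q]
        unfolding p_def by blast
      then have "j' \<in> Poly_Mapping.keys q" "j = n + j'"
        by (auto split: if_splits)
      then show ?thesis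
        using keys_q keys_n Poly_Mapping.keys_add [of n j'] by blast
    qed
    ultimately have smaller: "Poly_Mapping.keys j \<subseteq> V \<and> code ws j < code ws m"
      if "j \<in> Poly_Mapping.keys p" for j
      using that by (auto simp: below_def)
    have "\<exists>r. (\<forall>j\<in>Poly_Mapping.keys r. Poly_Mapping.keys j \<subseteq> V \<and> standard ws G j \<and> code ws j \<le> code ws m)
      \<and> subst \<chi> r = ev_mon \<chi> l" if "l \<in> Poly_Mapping.keys p" for l
    proof -
      have "card {n. Poly_Mapping.keys n \<subseteq> V \<and> code ws n < code ws l}
          < card {n. Poly_Mapping.keys n \<subseteq> V \<and> code ws n < code ws m}"
        using smaller [OF that] less.prems by (intro psubset_card_mono fin) auto
      then show ?thesis
        using less.hyps smaller [OF that] by (meson less_imp_le order_trans)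
    qed
    then show ?thesis unfolding p [symmetric] by (rule subst_replace_monomials)
  qed
qed

text \<open>If the leading monomial \<open>e\<close> were standard, straightening only the tail of
  \<open>f\<close> would give a kernel element supported on standard monomials that still contains
  \<open>e\<close>, against \<open>indep\<close>.\<close>

lemma kernel_lead_divisible:
  fixes G :: "'k::field mpoly set"
  assumes G: "\<And>g. g \<in> G \<Longrightarrow> subst \<chi> g = 0"
      "\<And>g n. g \<in> G \<Longrightarrow> n \<in> Poly_Mapping.keys g \<Longrightarrow> Poly_Mapping.keys n \<subseteq> V"
    and fin: "\<And>m. Poly_Mapping.keys m \<subseteq> V \<Longrightarrow>
      finite {n. Poly_Mapping.keys n \<subseteq> V \<and> code ws n < code ws m}"
    and indep: "\<And>r. (\<And>n. n \<in> Poly_Mapping.keys r \<Longrightarrow> Poly_Mapping.keys n \<subseteq> V \<and> standard ws G n) \<Longrightarrow>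
      subst \<chi> r = 0 \<Longrightarrow> r = 0"
    and f: "subst \<chi> f = 0" "\<And>n. n \<in> Poly_Mapping.keys f \<Longrightarrow> Poly_Mapping.keys n \<subseteq> V" "is_lead ws f e"
  shows "\<exists>g\<in>G. \<exists>e'. is_lead ws g e' \<and> mon_dvd e' e"
proof (rule ccontr)
  assume "\<not> ?thesis"
  then have std: "standard ws G e" by (auto simp: standard_def)
  obtain k q where q: "f = Poly_Mapping.single e k + q" "k \<noteq> 0" "below ws (code ws e) q"
    using f(3) by (rule is_leadE)
  have keys_q: "Poly_Mapping.keys j \<subseteq> V \<and> code ws j < code ws e" if "j \<in> Poly_Mapping.keys q" for j
  proof -
    have j: "code ws j < code ws e" using that q(3) by (auto simp: below_def)
    then have "j \<in> Poly_Mapping.keys f"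
      using that by (auto simp: q(1) in_keys_iff lookup_add lookup_single when_def)
    then show ?thesis using f(2) j by blast
  qed
  have keys_e: "Poly_Mapping.keys e \<subseteq> V"
    using f(2,3) by (auto simp: is_lead_def in_keys_iff)
  have "\<exists>r. (\<forall>j\<in>Poly_Mapping.keys r. Poly_Mapping.keys j \<subseteq> V \<and> standard ws G j \<and> code ws j < code ws e)
      \<and> subst \<chi> r = ev_mon \<chi> l" if l: "l \<in> Poly_Mapping.keys q" for l
  proof -
    obtain r where "\<forall>j\<in>Poly_Mapping.keys r. Poly_Mapping.keys j \<subseteq> V \<and> standard ws G j \<and> code ws j \<le> code ws l"
        "subst \<chi> r = ev_mon \<chi> l"
    proof -
      have "\<exists>r. (\<forall>j\<in>Poly_Mapping.keys r. Poly_Mapping.keys j \<subseteq> V \<and> standard ws G j \<and> code ws j \<le> code ws l)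
          \<and> subst \<chi> r = ev_mon \<chi> l"
        by (rule straighten, erule G(1), erule (1) G(2), erule fin) (use keys_q [OF l] in simp)
      then show ?thesis using that by blast
    qed
    then show ?thesis using keys_q [OF l] by (intro exI [of _ r]) auto
  qed
  then have "\<exists>r. (\<forall>j\<in>Poly_Mapping.keys r. Poly_Mapping.keys j \<subseteq> V \<and> standard ws G j \<and> code ws j < code ws e)
      \<and> subst \<chi> r = subst \<chi> q"
    by (rule subst_replace_monomials)
  then obtain r where
    r: "\<And>j. j \<in> Poly_Mapping.keys r \<Longrightarrow> Poly_Mapping.keys j \<subseteq> V \<and> standard ws G j \<and> code ws j < code ws e"
      "subst \<chi> r = subst \<chi> q" by blast
  let ?h = "Poly_Mapping.single e k + r"
  have "subst \<chi> ?h = 0"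
    using f(1) by (simp add: q(1) subst_add r(2))
  moreover have "Poly_Mapping.keys n \<subseteq> V \<and> standard ws G n" if "n \<in> Poly_Mapping.keys ?h" for n
    using that Poly_Mapping.keys_add [of "Poly_Mapping.single e k" r] r(1) keys_e std
    by (auto split: if_splits)
  ultimately have "?h = 0" by (rule indep [rotated]) auto
  moreover have "is_lead ws ?h e"
    using q(2) r(1) by (intro is_leadI) (auto simp: below_def)
  ultimately show False by (simp add: is_lead_def)
qed

subsection \<open>The order \<open>>\<^sub>E\<close>\<close>

text \<open>Least significant first, so conditions (i) to (vii) appear in reverse. "Rightmost
  nonzero entry negative" makes the last entry of a tuple decisive and the smaller exponent larger:
  each tuple keeps its order with negated indicators, and those of \<gamma> and \<beta> are followed
  by their degree sums.\<close>

definition wsE :: "nat \<Rightarrow> nat \<Rightarrow> nat \<Rightarrow> nat \<Rightarrow> (var \<Rightarrow> int) list" where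
  "wsE m0 d a b =
     map (\<lambda>u v. - of_bool (v = u)) [X 1, X 2, X 3, X 0] @
     map (\<lambda>u v. - of_bool (v = u)) [Phi 2 2, Phi 1 2, Phi 1 1] @
     [\<lambda>v. of_bool (v \<in> {Phi 2 2, Phi 1 2, Phi 1 1})] @
     map (\<lambda>j v. - of_bool (v = Psi j)) [0..<4 - b] @
     [\<lambda>v. of_bool (v \<in> Psi ` {0..<4 - b}), \<lambda>v. int (weight m0 d a b v), \<lambda>v. of_bool (v = T)]"

lemma wt_indicator: "finite A \<Longrightarrow> wt (\<lambda>v. of_bool (v \<in> A)) m = (\<Sum>u\<in>A. int (Poly_Mapping.lookup m u))"
  by (subst wt_superset [of "A \<union> Poly_Mapping.keys m"])
     (auto intro!: sum.mono_neutral_cong_right)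

lemma wt_uminus: "wt (\<lambda>v. - w v) m = - wt w m"
  by (simp add: wt_def sum_negf)

lemma wt_of_bool [simp]:
  "wt (\<lambda>v. of_bool (v = u)) m = int (Poly_Mapping.lookup m u)"
  using wt_indicator [of "{u}" m] by simp

lemma wt_neg_of_bool [simp]: "wt (\<lambda>v. - of_bool (v = u)) m = - int (Poly_Mapping.lookup m u)"
  using wt_uminus [of "\<lambda>v. of_bool (v = u)" m] by simp

lemma wt_weight: "wt (\<lambda>v. int (weight m0 d a b v)) m = int (omega m0 d a b m)"
proof -
  have "wt (\<lambda>v. int (weight m0 d a b v)) m =
      (\<Sum>v\<in>Poly_Mapping.keys m - {T}. int (weight m0 d a b v) * int (Poly_Mapping.lookup m v))"
    unfolding wt_def by (intro sum.mono_neutral_right) (auto simp: weight_def)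
  then show ?thesis by (simp add: omega_def)
qed

lemma code_wsE:
  "code (wsE m0 d a b) m = Poly (map uminus (alpha m) @ map uminus (gamma m) @ sum_list (gamma m) #
     map uminus (beta b m) @ [sum_list (beta b m), int (omega m0 d a b m), int (Poly_Mapping.lookup m T)])"
  unfolding code_def wsE_def map_append
  by (simp add: alpha_def gamma_def beta_def wt_weight wt_indicator comp_def
      sum.reindex inj_on_def interv_sum_list_conv_sum_set_nat del: upt_Suc insert_iff) simp

lemma rightmost_neg_Nil [simp]: "\<not> rightmost_neg [] []"
  by (simp add: rightmost_neg_def)

lemma rightmost_neg_Cons [simp]:
  assumes "length xs = length ys"
  shows "rightmost_neg (x # xs) (y # ys) \<longleftrightarrow> rightmost_neg xs ys \<or> (xs = ys \<and> x < y)"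
proof -
  have "filter (\<lambda>z. z \<noteq> 0) (map2 (-) xs ys) = [] \<longleftrightarrow> xs = ys"
    using assms by (induction xs ys rule: list_induct2) auto
  then show ?thesis by (auto simp: rightmost_neg_def Let_def)
qed

lemma rightmost_neg_same [simp]: "\<not> rightmost_neg xs xs"
  by (induction xs) auto

lemma Poly_neg_eq_iff:
  fixes xs ys us vs :: "int list"
  assumes "length xs = length ys"
  shows "Poly (map uminus xs @ us) = Poly (map uminus ys @ vs) \<longleftrightarrow> xs = ys \<and> Poly us = Poly vs"
  using assms by (induction xs ys rule: list_induct2) auto

text \<open>\<open>int poly\<close> compares from the top coefficient down: first the tail beyond
  the tuple, then the tuple from its right end, with the sign reversed by the negation.\<close>

lemma Poly_neg_less_iff:
  fixes xs ys us vs :: "int list"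
  assumes "length xs = length ys"
  shows "Poly (map uminus ys @ vs) < Poly (map uminus xs @ us) \<longleftrightarrow>
    Poly vs < Poly us \<or> (Poly us = Poly vs \<and> rightmost_neg xs ys)"
  using assms
proof (induction xs ys rule: list_induct2)
  case (Cons x xs y ys)
  then show ?case
    using Poly_neg_eq_iff [of ys xs vs us] by (auto simp: less_pCons_iff)
qed auto

text \<open>Replaces the case distinction in >_E by one additive code. Which condition applies
  depends on whether the t-degree, \<omega>, \<beta> and \<gamma> agree, hence the four case
  splits.\<close>

lemma gtE_iff: "gtE m0 d a b m n \<longleftrightarrow> code (wsE m0 d a b) n < code (wsE m0 d a b) m"
proof -
  have "length (alpha m) = length (alpha n)" "length (gamma m) = length (gamma n)"
      "length (beta b m) = length (beta b n)"
    by (simp_all add: alpha_def beta_def gamma_def)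
  then show ?thesis
    unfolding code_wsE gtE_def Let_def
    by (cases "Poly_Mapping.lookup m T = Poly_Mapping.lookup n T";
        cases "omega m0 d a b m = omega m0 d a b n";
        cases "beta b m = beta b n"; cases "gamma m = gamma n")
       (auto simp: Poly_neg_less_iff Poly_neg_eq_iff less_pCons_iff)
qed

lemma finite_vars_R: "finite (vars_R b)"
  by (simp add: vars_R_def)

lemma T_notin_vars_R: "T \<notin> vars_R b"
  by (auto simp: vars_R_def)

lemma code_wsE_inj:
  assumes "b \<le> 3" "Poly_Mapping.keys m \<subseteq> vars_R b" "Poly_Mapping.keys n \<subseteq> vars_R b"
    and "code (wsE m0 d a b) m = code (wsE m0 d a b) n"
  shows "m = n"
proof -
  have "length (alpha m) = length (alpha n)" "length (gamma m) = length (gamma n)"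
      "length (beta b m) = length (beta b n)"
    by (simp_all add: alpha_def beta_def gamma_def)
  then have eq: "alpha m = alpha n" "gamma m = gamma n" "beta b m = beta b n"
    using assms(4) unfolding code_wsE by (simp_all add: Poly_neg_eq_iff)
  have "Poly_Mapping.lookup m v = Poly_Mapping.lookup n v" if "v \<in> vars_R b" for v
    using that eq assms(1) by (auto simp: vars_R_def alpha_def gamma_def beta_def)
  then show ?thesis
    using assms(2,3) by (intro poly_mapping_eqI) (metis in_keys_iff subsetD)
qed

lemma lead_mon_eq:
  assumes "is_lead (wsE m0 d a b) f e"
  shows "lead_mon (gtE m0 d a b) f = e"
  unfolding lead_mon_def gtE_iff
proof (rule the_equality)
  show "e \<in> Poly_Mapping.keys f \<and> (\<forall>n\<in>Poly_Mapping.keys f. n \<noteq> e \<longrightarrow>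
      code (wsE m0 d a b) n < code (wsE m0 d a b) e)"
    using assms by (auto simp: is_lead_def in_keys_iff)
  then show "m = e" if "m \<in> Poly_Mapping.keys f \<and> (\<forall>n\<in>Poly_Mapping.keys f. n \<noteq> m \<longrightarrow>
      code (wsE m0 d a b) n < code (wsE m0 d a b) m)" for m
    using that by (metis order_less_asym)
qed

lemma finite_monomials_bounded:
  assumes "finite V"
  shows "finite {m :: 'a \<Rightarrow>\<^sub>0 nat. Poly_Mapping.keys m \<subseteq> V \<and> (\<forall>v\<in>V. Poly_Mapping.lookup m v \<le> N)}"
proof -
  have "finite {f :: 'a \<Rightarrow> nat. \<forall>x. (x \<in> V \<longrightarrow> f x \<in> {..N}) \<and> (x \<notin> V \<longrightarrow> f x = 0)}"
    using assms by (intro finite_set_of_finite_funs) auto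
  moreover have "Poly_Mapping.lookup ` {m. Poly_Mapping.keys m \<subseteq> V \<and> (\<forall>v\<in>V. Poly_Mapping.lookup m v \<le> N)}
      \<subseteq> {f. \<forall>x. (x \<in> V \<longrightarrow> f x \<in> {..N}) \<and> (x \<notin> V \<longrightarrow> f x = 0)}"
    by (auto simp: in_keys_iff subset_iff)
  moreover have "inj_on Poly_Mapping.lookup M" for M :: "('a \<Rightarrow>\<^sub>0 nat) set"
    by (intro inj_onI poly_mapping_eqI) (rule fun_cong)
  ultimately show ?thesis
    using finite_imageD finite_subset by blast
qed

lemma lookup_le_omega:
  assumes "0 < m0" "v \<noteq> T"
  shows "Poly_Mapping.lookup m v \<le> omega m0 d a b m"
proof (cases "v \<in> Poly_Mapping.keys m")
  case True
  have "1 \<le> weight m0 d a b v"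
    using assms by (cases v) (auto simp: weight_def mm_def)
  then have "Poly_Mapping.lookup m v \<le> weight m0 d a b v * Poly_Mapping.lookup m v"
    by simp
  also have "\<dots> \<le> omega m0 d a b m"
    unfolding omega_def using True assms(2)
    by (intro member_le_sum [where f = "\<lambda>v. weight m0 d a b v * Poly_Mapping.lookup m v"]) auto
  finally show ?thesis .
qed (simp add: in_keys_iff)

text \<open>Without \<open>T\<close>, a smaller monomial has no larger \<omega>, and \<omega> bounds
  all exponents because every weight is positive. The negated weights in \<open>wsE\<close> would
  give no such bound.\<close>

lemma finite_wsE_smaller:
  assumes "0 < m0" "Poly_Mapping.keys m \<subseteq> vars_R b"
  shows "finite {n. Poly_Mapping.keys n \<subseteq> vars_R b \<and> code (wsE m0 d a b) n < code (wsE m0 d a b) m}"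
proof (rule finite_subset)
  show "finite {n. Poly_Mapping.keys n \<subseteq> vars_R b \<and>
      (\<forall>v\<in>vars_R b. Poly_Mapping.lookup n v \<le> omega m0 d a b m)}"
    by (intro finite_monomials_bounded finite_vars_R)
  have "Poly_Mapping.lookup n v \<le> omega m0 d a b m"
    if n: "Poly_Mapping.keys n \<subseteq> vars_R b" "gtE m0 d a b m n" and v: "v \<in> vars_R b" for n v
  proof -
    have "Poly_Mapping.lookup m T = 0" "Poly_Mapping.lookup n T = 0"
      using assms(2) n(1) T_notin_vars_R by (metis in_keys_iff subsetD)+
    then have "omega m0 d a b n \<le> omega m0 d a b m"
      using n(2) by (auto simp: gtE_def Let_def)
    moreover have "Poly_Mapping.lookup n v \<le> omega m0 d a b n"
      using v T_notin_vars_R assms(1) by (intro lookup_le_omega) auto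
    ultimately show ?thesis by simp
  qed
  then show "{n. Poly_Mapping.keys n \<subseteq> vars_R b \<and> code (wsE m0 d a b) n < code (wsE m0 d a b) m}
    \<subseteq> {n. Poly_Mapping.keys n \<subseteq> vars_R b \<and> (\<forall>v\<in>vars_R b. Poly_Mapping.lookup n v \<le> omega m0 d a b m)}"
    by (auto simp flip: gtE_iff)
qed

subsection \<open>The polynomials lie in the kernel\<close>

lemma R_b_add: "p \<in> R_b b \<Longrightarrow> q \<in> R_b b \<Longrightarrow> p + q \<in> R_b b"
  for p q :: "'k::comm_ring_1 mpoly"
  using Poly_Mapping.keys_add [of p q] by (auto simp: R_b_def)

lemma R_b_uminus: "p \<in> R_b b \<Longrightarrow> - p \<in> R_b b"
  for p :: "'k::comm_ring_1 mpoly"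
  by (auto simp: R_b_def in_keys_iff)

lemma R_b_diff: "p \<in> R_b b \<Longrightarrow> q \<in> R_b b \<Longrightarrow> p - q \<in> R_b b"
  for p q :: "'k::comm_ring_1 mpoly"
  using R_b_add [of p b "- q"] by (simp add: R_b_uminus)

lemma R_b_0: "0 \<in> R_b b" and R_b_1: "(1 :: 'k::comm_ring_1 mpoly) \<in> R_b b"
  by (auto simp: R_b_def)

lemma R_b_mult:
  fixes p q :: "'k::comm_ring_1 mpoly"
  assumes "p \<in> R_b b" "q \<in> R_b b"
  shows "p * q \<in> R_b b"
  unfolding R_b_def
proof (intro CollectI ballI)
  fix m assume "m \<in> Poly_Mapping.keys (p * q)"
  then obtain i j where "m = i + j" "i \<in> Poly_Mapping.keys p" "j \<in> Poly_Mapping.keys q"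
    using Poly_Mapping.keys_mult [of p q] by blast
  then show "Poly_Mapping.keys m \<subseteq> vars_R b"
    using Poly_Mapping.keys_add [of i j] assms by (auto simp: R_b_def)
qed

lemma R_b_power: "p \<in> R_b b \<Longrightarrow> p ^ n \<in> R_b b"
  for p :: "'k::comm_ring_1 mpoly"
  by (induction n) (auto simp: R_b_1 R_b_mult)

lemma R_b_Var: "v \<in> vars_R b \<Longrightarrow> Var v \<in> R_b b"
  by (auto simp: Var_def R_b_def)

lemma R_b_Xv: "Xv i \<in> R_b b"
proof -
  have "i \<in> {0, 1, 2, 3}" if "0 \<le> i" "i \<le> 3" using that by auto
  then show ?thesis by (auto simp: Xv_def vars_R_def intro!: R_b_Var R_b_0)
qed

lemma R_b_Psiv: "b \<le> 3 \<Longrightarrow> Psiv b i \<in> R_b b"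
  by (auto simp: Psiv_def vars_R_def intro!: R_b_Var R_b_0)

lemma R_b_Phiv: "Phiv i j \<in> R_b b"
  by (auto simp: Phiv_def vars_R_def intro!: R_b_Var R_b_0)

lemmas R_b_intros = R_b_add R_b_diff R_b_uminus R_b_mult R_b_power R_b_0 R_b_1 R_b_Xv R_b_Psiv R_b_Phiv

lemma phi_small_R_b: "phi_small i j \<in> R_b b"
  by (simp add: phi_small_def R_b_intros)

lemma subst_Xv [simp]: "subst (phi_map a d b) (Xv i) = Xv i"
  by (simp add: Xv_def phi_map_def)

lemma subst_Phiv [simp]: "subst (phi_map a d b) (Phiv i j) = phi_small i j * Var T"
  by (auto simp: Phiv_def phi_map_def phi_small_def)

lemma subst_Psiv [simp]: "subst (phi_map a d b) (Psiv b j) =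
    (if 0 \<le> j \<and> j \<le> 3 - int b then psi_small a d b j * Var T else 0)"
  by (simp add: Psiv_def phi_map_def)

lemma GB_subset_E_b:
  assumes "1 \<le> a" "b \<in> {1, 2}"
  shows "GB a d b \<subseteq> (E_b a d b :: 'k::comm_ring_1 mpoly set)"
proof
  fix g :: "'k mpoly" assume g: "g \<in> GB a d b"
  \<comment> \<open>Removes the truncated subtraction in the exponents \<open>a - 1\<close> and
    \<open>a + d - 1\<close> of the Q's before ring normalisation.\<close>
  obtain a' where a: "a = Suc a'" using assms(1) by (cases a) auto
  note ring = algebra_simps power2_eq_square power3_eq_cube power_add
  have A: "subst (phi_map a d b) (polyA a d i b j) = 0" if "i \<in> {1,2,3}" "0 \<le> j" "j \<le> 2 - int b" for i j
  proof -
    have "j = 0 \<or> j = 1 \<and> b = 1" using that(2,3) assms(2) by auto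
    then show ?thesis using that(1) assms(2)
      by (elim insertE disjE conjE emptyE; simp add: polyA_def eps_def subst_simps phi_small_def psi_small_def;
          simp add: Xv_def ring)
  qed
  have B: "subst (phi_map a d b) (polyB a d b i j) = 0" for i j
    using assms(2)
      by (elim insertE disjE conjE emptyE; simp add: polyB_def subst_simps psi_small_def;
          simp add: phi_small_def subst_simps ring)
  have "subst (phi_map a d b) g = 0"
    using g assms(2) unfolding GB_def
    apply (elim UnE)
    subgoal using A by blast
    subgoal using B by blast
    subgoal by (auto simp: polyD_def polyL_def subst_simps phi_small_def; simp add: Xv_def ring)
    subgoal by (auto simp: polyQ11_def polyQ12_def polyQ21_def subst_simps phi_small_def psi_small_def split: if_splits;
         simp add: a ring)
    done
  moreover have "g \<in> R_b b"
    using g assms(2) unfolding GB_def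
    by (auto simp: polyA_def polyB_def polyD_def polyL_def polyQ11_def polyQ12_def polyQ21_def
        phi_small_R_b split: if_splits intro!: R_b_intros)
  ultimately show "g \<in> E_b a d b" by (simp add: E_b_def)
qed

subsection \<open>Leading monomials of the basis\<close>

lemma is_lead_add: "is_lead ws p e \<Longrightarrow> below ws (code ws e) q \<Longrightarrow> is_lead ws (p + q) e"
  for p q :: "'k::comm_ring_1 mpoly"
  by (metis (no_types, lifting) add.assoc below_add is_leadE is_leadI)

lemma is_lead_diff: "is_lead ws p e \<Longrightarrow> below ws (code ws e) q \<Longrightarrow> is_lead ws (p - q) e"
  for p q :: "'k::comm_ring_1 mpoly"
  using is_lead_add [of ws p e "- q"] by (simp add: below_uminus)

lemma is_lead_single: "k \<noteq> 0 \<Longrightarrow> is_lead ws (Poly_Mapping.single e k) e"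
  for k :: "'k::comm_ring_1"
  using is_leadI [of k ws e 0] by simp

lemma single_power:
  "Poly_Mapping.single (Poly_Mapping.single v k) (1 :: 'k::comm_ring_1) ^ n =
    Poly_Mapping.single (Poly_Mapping.single v (n * k)) 1"
  by (induction n) (simp_all add: mult_single flip: single_add)

lemmas Var_monomial = single_power mult_single Var_def

abbreviation monE :: "var list \<Rightarrow> (var \<Rightarrow>\<^sub>0 nat)" where
  "monE vs \<equiv> (\<Sum>v\<leftarrow>vs. Poly_Mapping.single v 1)"

lemma wsE_1: "wsE m0 d a 1 =
   [\<lambda>v. - of_bool (v = X 1), \<lambda>v. - of_bool (v = X 2), \<lambda>v. - of_bool (v = X 3), \<lambda>v. - of_bool (v = X 0),
    \<lambda>v. - of_bool (v = Phi 2 2), \<lambda>v. - of_bool (v = Phi 1 2), \<lambda>v. - of_bool (v = Phi 1 1),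
    \<lambda>v. of_bool (v \<in> {Phi 2 2, Phi 1 2, Phi 1 1}),
    \<lambda>v. - of_bool (v = Psi 0), \<lambda>v. - of_bool (v = Psi 1), \<lambda>v. - of_bool (v = Psi 2),
    \<lambda>v. of_bool (v \<in> {Psi 0, Psi 1, Psi 2}), \<lambda>v. int (weight m0 d a 1 v), \<lambda>v. of_bool (v = T)]"
proof -
  have "[0..<4 - 1] = [0, 1, 2 :: nat]" by (simp add: upt_rec)
  moreover have "{0..<4 - 1} = {0, 1, 2 :: nat}" by auto
  ultimately show ?thesis by (simp add: wsE_def)
qed

lemma wsE_2: "wsE m0 d a 2 =
   [\<lambda>v. - of_bool (v = X 1), \<lambda>v. - of_bool (v = X 2), \<lambda>v. - of_bool (v = X 3), \<lambda>v. - of_bool (v = X 0),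
    \<lambda>v. - of_bool (v = Phi 2 2), \<lambda>v. - of_bool (v = Phi 1 2), \<lambda>v. - of_bool (v = Phi 1 1),
    \<lambda>v. of_bool (v \<in> {Phi 2 2, Phi 1 2, Phi 1 1}),
    \<lambda>v. - of_bool (v = Psi 0), \<lambda>v. - of_bool (v = Psi 1),
    \<lambda>v. of_bool (v \<in> {Psi 0, Psi 1}), \<lambda>v. int (weight m0 d a 2 v), \<lambda>v. of_bool (v = T)]"
proof -
  have "[0..<4 - 2] = [0, 1 :: nat]" by (simp add: upt_rec)
  moreover have "{0..<4 - 2} = {0, 1 :: nat}" by auto
  ultimately show ?thesis by (simp add: wsE_def)
qed

lemmas wsE_code_simps = code_def wsE_1 wsE_2 wt_add weight_def mm_def less_pCons_iff
lemmas lead_rules = is_lead_add is_lead_diff is_lead_single below_add below_diff below_uminus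

lemma single_twice:
  "Poly_Mapping.single v 1 + (Poly_Mapping.single v 1 + m) = Poly_Mapping.single v (2::nat) + m"
  "Poly_Mapping.single v 1 + Poly_Mapping.single v 1 = Poly_Mapping.single v (2::nat)"
  by (simp_all add: numeral_2_eq_2 flip: single_add add.assoc)

lemmas poly_monomials = single_twice polyA_def polyB_def polyD_def polyL_def polyQ11_def polyQ12_def polyQ21_def
  phi_small_def eps_def Xv_def Phiv_def Psiv_def Var_monomial left_diff_distrib right_diff_distrib

text \<open>Since m_0 = 3a + b gives (a + d) m_0 = a m_3 + b d, every polynomial of the basis is
  \<omega>-homogeneous, so \<beta>, \<gamma>, \<alpha> decide. Here the terms with
  \<open>Psi\<close> beat those with \<open>Phi\<close>, and the smaller \<open>Psi\<close> index
  wins.\<close>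

lemma lead_A_1:
  assumes "m0 = 3 * a + 1" "i \<in> {1, 2, 3}" "j \<in> {0, 1}"
  shows "is_lead (wsE m0 d a 1) (polyA a d i 1 j :: 'k::comm_ring_1 mpoly) (monE [X (nat i), Psi (nat j)])"
  using assms
  apply (elim insertE emptyE; simp add: poly_monomials add.assoc flip: One_nat_def)
  apply (intro lead_rules below_single disjI2; simp add: wsE_code_simps algebra_simps flip: One_nat_def)+
  done

lemma lead_A_2:
  assumes "m0 = 3 * a + 2" "i \<in> {1, 2, 3}"
  shows "is_lead (wsE m0 d a 2) (polyA a d i 2 0 :: 'k::comm_ring_1 mpoly) (monE [X (nat i), Psi 0])"
  using assms
  apply (elim insertE emptyE; simp add: poly_monomials add.assoc flip: One_nat_def)
  apply (intro lead_rules below_single disjI2; simp add: wsE_code_simps algebra_simps flip: One_nat_def)+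
  done

text \<open>Both monomials of phi(i,j) carry the same \<open>Psi\<close>, so \<alpha> decides: the
  losing one contains the variable furthest right in X_1, X_2, X_3, X_0. Pairs with i \<le> j are
  enough, as phi and Phi are symmetric.\<close>

lemma lead_B_1:
  assumes "m0 = 3 * a + 1" "(i, j) \<in> {(1, 1), (1, 2), (2, 2)}"
  shows "is_lead (wsE m0 d a 1) (polyB a d 1 i j :: 'k::comm_ring_1 mpoly) (monE [X (nat i), X (nat j), Psi 2])"
  using assms
  apply (elim insertE emptyE; simp add: poly_monomials add.assoc flip: One_nat_def)
  apply (intro lead_rules below_single disjI2; simp add: wsE_code_simps algebra_simps flip: One_nat_def)+
  done

lemma lead_D_1:
  assumes "m0 = 3 * a + 1"
  shows "is_lead (wsE m0 d a 1) (polyD :: 'k::comm_ring_1 mpoly) (monE [X 1, X 1, Phi 1 2])"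
  using assms
  apply (simp add: poly_monomials add.assoc flip: One_nat_def)
  apply (intro lead_rules below_single disjI2; simp add: wsE_code_simps algebra_simps flip: One_nat_def)+
  done

lemma lead_L_1:
  assumes "m0 = 3 * a + 1" "i \<in> {0, 1}"
  shows "is_lead (wsE m0 d a 1) (polyL i :: 'k::comm_ring_1 mpoly) (monE [X (nat i), Phi 2 2])"
  using assms
  apply (elim insertE emptyE; simp add: poly_monomials add.assoc flip: One_nat_def)
  apply (intro lead_rules below_single disjI2; simp add: wsE_code_simps algebra_simps flip: One_nat_def)+
  done

lemma lead_B_2:
  assumes "m0 = 3 * a + 2" "(i, j) \<in> {(1, 1), (1, 2), (2, 2)}"
  shows "is_lead (wsE m0 d a 2) (polyB a d 2 i j :: 'k::comm_ring_1 mpoly) (monE [X (nat i), X (nat j), Psi 1])"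
  using assms
  apply (elim insertE emptyE; simp add: poly_monomials add.assoc flip: One_nat_def)
  apply (intro lead_rules below_single disjI2; simp add: wsE_code_simps algebra_simps flip: One_nat_def)+
  done

lemma lead_D_2:
  assumes "m0 = 3 * a + 2"
  shows "is_lead (wsE m0 d a 2) (polyD :: 'k::comm_ring_1 mpoly) (monE [X 1, X 1, Phi 1 2])"
  using assms
  apply (simp add: poly_monomials add.assoc flip: One_nat_def)
  apply (intro lead_rules below_single disjI2; simp add: wsE_code_simps algebra_simps flip: One_nat_def)+
  done

lemma lead_L_2:
  assumes "m0 = 3 * a + 2" "i \<in> {0, 1}"
  shows "is_lead (wsE m0 d a 2) (polyL i :: 'k::comm_ring_1 mpoly) (monE [X (nat i), Phi 2 2])"
  using assms
  apply (elim insertE emptyE; simp add: poly_monomials add.assoc flip: One_nat_def)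
  apply (intro lead_rules below_single disjI2; simp add: wsE_code_simps algebra_simps flip: One_nat_def)+
  done

lemma lead_Q11:
  assumes "m0 = 3 * a + 1"
  shows "is_lead (wsE m0 d a 1) (polyQ11 :: 'k::comm_ring_1 mpoly) (monE [Psi 0, Phi 2 2])"
  using assms
  apply (simp add: poly_monomials add.assoc flip: One_nat_def)
  apply (intro lead_rules below_single disjI2; simp add: wsE_code_simps algebra_simps flip: One_nat_def)+
  done

text \<open>Only Psi(1,1)^2 and Psi(1,2) Psi(1,0) have two \<open>Psi\<close> factors, and Psi(1,2)
  makes the second smaller. \<open>1 \<le> a\<close> makes \<open>a - 1\<close> a true predecessor,
  so that the weights \<omega> tie.\<close>

lemma lead_Q12:
  assumes "m0 = 3 * a + 1" "1 \<le> a"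
  shows "is_lead (wsE m0 d a 1) (polyQ12 a d :: 'k::comm_ring_1 mpoly) (monE [Psi 1, Psi 1])"
  using assms
  apply (simp add: poly_monomials add.assoc flip: One_nat_def)
  apply (intro lead_rules below_single disjI2; simp add: wsE_code_simps algebra_simps flip: One_nat_def)+
  done

lemma lead_Q21:
  assumes "m0 = 3 * a + 2" "1 \<le> a"
  shows "is_lead (wsE m0 d a 2) (polyQ21 a d :: 'k::comm_ring_1 mpoly) (monE [Psi 0, Psi 0, Phi 2 2])"
  using assms
  apply (simp add: poly_monomials add.assoc flip: One_nat_def)
  apply (intro lead_rules below_single disjI2; simp add: wsE_code_simps algebra_simps flip: One_nat_def)+
  done

subsection \<open>Independence of the standard monomials\<close>

text \<open>\<open>a0\<close> to \<open>a3\<close> are the exponents of the X_i, \<open>g\<close>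
  that of Phi(2,2), and \<open>u\<close> sums 3 - b - j over the factors Psi(b,j). The restrictions
  are those of standard monomials with a \<open>Psi\<close>; \<open>n\<close> and \<open>e\<close>
  compare the x- and v-degrees of the images, up to contributions already known to agree.\<close>

lemma weights_determine_exponents:
  fixes a0 a1 a2 a3 u g c0 c1 c2 c3 v h :: int
  assumes nn: "0\<le>a0" "0\<le>a1" "0\<le>a2" "0\<le>a3" "0\<le>u" "0\<le>g" "0\<le>c0" "0\<le>c1" "0\<le>c2" "0\<le>c3" "0\<le>v" "0\<le>h"
  and s: "u = 0 \<longrightarrow> a1 + a2 \<le> 1" "u \<noteq> 0 \<longrightarrow> a1 = 0 \<and> a2 = 0 \<and> a3 = 0" "g \<noteq> 0 \<longrightarrow> a0 = 0 \<and> a1 = 0 \<and> u \<le> 1"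
  and t: "v = 0 \<longrightarrow> c1 + c2 \<le> 1" "v \<noteq> 0 \<longrightarrow> c1 = 0 \<and> c2 = 0 \<and> c3 = 0" "h \<noteq> 0 \<longrightarrow> c0 = 0 \<and> c1 = 0 \<and> v \<le> 1"
  and n: "a0 + a1 + a2 + a3 = c0 + c1 + c2 + c3"
  and e: "a1 + 2 * a2 + 3 * a3 + 2 * g - u = c1 + 2 * c2 + 3 * c3 + 2 * h - v"
  shows "a0 = c0 \<and> a1 = c1 \<and> a2 = c2 \<and> a3 = c3 \<and> u = v \<and> g = h"
proof -
  \<comment> \<open>Equation \<open>e\<close> minus three times \<open>n\<close>. The left side is
    positive exactly when \<open>g \<noteq> 0\<close>, since then \<open>a0 = a1 = 0\<close> and
    \<open>a2 + u \<le> 1\<close>; its sign therefore tells whether Phi(2,2) occurs.\<close>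
  have e': "2 * g - (3 * a0 + 2 * a1 + a2 + u) = 2 * h - (3 * c0 + 2 * c1 + c2 + v)"
    using n e by linarith
  have pos: "a2 + u \<le> 1" if "g \<noteq> 0" using that nn s by (cases "u = 0") auto
  have pos': "c2 + v \<le> 1" if "h \<noteq> 0" using that nn t by (cases "v = 0") auto
  have "g = 0 \<longleftrightarrow> h = 0"
  proof (cases "g = 0"; cases "h = 0")
    assume "g = 0" "h \<noteq> 0" 
    then have "c2 + v \<le> 1" "c0 = 0" "c1 = 0" using pos' t by auto
    then show ?thesis using e' nn \<open>g = 0\<close> \<open>h \<noteq> 0\<close> by linarith
  next
    assume "g \<noteq> 0" "h = 0" 
    then have "a2 + u \<le> 1" "a0 = 0" "a1 = 0" using pos s by auto
    then show ?thesis using e' nn \<open>g \<noteq> 0\<close> \<open>h = 0\<close> by linarith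
  qed auto
  then consider "g = 0" "h = 0" | "g \<noteq> 0" "h \<noteq> 0" by blast
  then show ?thesis
  proof cases
    case 1
    \<comment> \<open>Now the sign of the two sides of \<open>e\<close> decides: negative exactly
      when \<open>u \<noteq> 0\<close>.\<close>
    have "u = 0 \<longleftrightarrow> v = 0"
      using e s(2) t(2) nn 1 by (cases "u = 0"; cases "v = 0") auto
    then consider "u = 0" "v = 0" "a1 + a2 \<le> 1" "c1 + c2 \<le> 1" | "u \<noteq> 0" "v \<noteq> 0" using s t by blast
    then show ?thesis
    proof cases
      case 1
      \<comment> \<open>Division by 3: \<open>a1 + 2 * a2\<close> is at most 2, hence the remainder,
        and \<open>a3\<close> is the quotient.\<close>
      have "a1 + 2 * a2 = c1 + 2 * c2 \<and> a3 = c3"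
        using e 1 \<open>g = 0\<close> \<open>h = 0\<close> nn(2,3) nn(8,9) by presburger
      then have "a1 = c1 \<and> a2 = c2" using 1 nn(2,3) nn(8,9) by presburger
      then show ?thesis using 1 \<open>g = 0\<close> \<open>h = 0\<close> e n by auto
    next
      case 2
      then show ?thesis using s t n e \<open>g = 0\<close> \<open>h = 0\<close> by auto
    qed
  next
    case 2
    then have z: "a0 = 0" "a1 = 0" "c0 = 0" "c1 = 0" "a2 + u \<le> 1" "c2 + v \<le> 1"
      using s t pos pos' by auto
    \<comment> \<open>Parity: \<open>a2 + u\<close> and \<open>c2 + v\<close> are 0 or 1.\<close>
    then have "g = h \<and> a2 + u = c2 + v"
      using e' nn(3,5) nn(9,11) by presburger
    moreover have "u = v"
      using z n calculation s(2) t(2) nn by (cases "u = 0"; cases "v = 0") auto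
    ultimately show ?thesis using z n by auto
  qed
qed

text \<open>\<open>g1\<close>, \<open>g2\<close>, \<open>g3\<close> are the exponents of Phi(2,2),
  Phi(1,2), Phi(1,1), whose images lead with X_1 X_3, X_0 X_3, X_1^2. The equations in
  \<open>e\<close> compare the degrees in t, X_3, X_1, X_0, X_2; \<open>s\<close> and
  \<open>t\<close> come from L(0), L(1) and D.\<close>

lemma weights_determine_Psi_free_exponents:
  fixes a0 a1 a2 a3 g1 g2 g3 c0 c1 c2 c3 h1 h2 h3 :: int
  assumes nn: "0\<le>a0" "0\<le>a1" "0\<le>a2" "0\<le>a3" "0\<le>g1" "0\<le>g2" "0\<le>g3"
     "0\<le>c0" "0\<le>c1" "0\<le>c2" "0\<le>c3" "0\<le>h1" "0\<le>h2" "0\<le>h3"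
  and s: "g1 \<noteq> 0 \<longrightarrow> a0 = 0 \<and> a1 = 0" "g2 \<noteq> 0 \<longrightarrow> a1 \<le> 1"
  and t: "h1 \<noteq> 0 \<longrightarrow> c0 = 0 \<and> c1 = 0" "h2 \<noteq> 0 \<longrightarrow> c1 \<le> 1"
  and e: "g1 + g2 + g3 = h1 + h2 + h3" "a3 + g1 + g2 = c3 + h1 + h2" "a1 + 2 * g3 + g1 = c1 + 2 * h3 + h1"
    "a0 + g2 = c0 + h2" "a2 = c2"
  shows "a0 = c0 \<and> a1 = c1 \<and> a2 = c2 \<and> a3 = c3 \<and> g1 = h1 \<and> g2 = h2 \<and> g3 = h3"
proof -
  \<comment> \<open>The X_1-degree plus twice the X_0-degree minus twice the t-degree. It is
    negative exactly when \<open>g1 \<noteq> 0\<close>, and then equals \<open>- g1\<close>.\<close>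
  have e': "a1 + 2 * a0 - g1 = c1 + 2 * c0 - h1" using e by linarith
  have "g1 = h1"
    using e' s(1) t(1) nn by (cases "g1 = 0"; cases "h1 = 0") auto
  moreover have "a1 = c1"
  proof (cases "g1 = 0")
    case True
    \<comment> \<open>Either D bounds both exponents of X_1 by 1, so that parity in
      \<open>e'\<close> identifies them, or Phi(1,2) agrees, and then so do X_0 and X_1.\<close>
    have "a1 \<le> 1 \<and> c1 \<le> 1 \<or> g2 = h2"
      using True \<open>g1 = h1\<close> s(2) t(2) e nn by (cases "g2 = 0"; cases "h2 = 0") auto
    then show ?thesis using e' e(1,3,4) \<open>g1 = h1\<close> nn(2) nn(9) by presburger
  qed (use s t calculation in auto)
  ultimately show ?thesis using e e' by auto
qed

section \<open>Exponent restrictions on standard monomials\<close>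

lemma lookup_monE: "Poly_Mapping.lookup (monE vs) v = count_list vs v"
  by (induction vs) (auto simp: lookup_add lookup_single when_def)

lemma mon_dvd_monE: "mon_dvd (monE vs) m \<longleftrightarrow> (\<forall>v\<in>set vs. count_list vs v \<le> Poly_Mapping.lookup m v)"
  unfolding mon_dvd_def lookup_monE by (metis count_notin le0)

lemma not_mon_dvd_standard:
  "standard ws G m \<Longrightarrow> is_lead ws g e \<Longrightarrow> g \<in> G \<Longrightarrow> \<not> mon_dvd e m"
  by (auto simp: standard_def)

lemma polyA_in_GB: "i \<in> {1, 2, 3} \<Longrightarrow> 0 \<le> j \<Longrightarrow> j \<le> 2 - int b \<Longrightarrow> polyA a d i b j \<in> GB a d b"
  and polyB_in_GB: "i \<in> {1, 2} \<Longrightarrow> j \<in> {1, 2} \<Longrightarrow> polyB a d b i j \<in> GB a d b"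
  and polyL_in_GB: "i \<in> {0, 1} \<Longrightarrow> polyL i \<in> GB a d b"
  unfolding GB_def by blast+

text \<open>The restrictions come, in order, from A; from B, whose leading monomials exclude all
  quadratic monomials in X_1, X_2; from L(0), L(1) and Q(1,1); from D; and from Q(1,2).\<close>

lemma standard_1:
  fixes m0 a d :: nat and m :: "var \<Rightarrow>\<^sub>0 nat"
  defines "l \<equiv> Poly_Mapping.lookup m"
  assumes m0: "m0 = 3 * a + 1" "1 \<le> a" and std: "standard (wsE m0 d a 1) (GB a d 1 :: 'k::field mpoly set) m"
  shows "l (Psi 0) \<noteq> 0 \<or> l (Psi 1) \<noteq> 0 \<Longrightarrow> l (X 1) = 0 \<and> l (X 2) = 0 \<and> l (X 3) = 0"
    "l (Psi 2) \<noteq> 0 \<Longrightarrow> l (X 1) + l (X 2) \<le> 1"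
    "l (Phi 2 2) \<noteq> 0 \<Longrightarrow> l (X 0) = 0 \<and> l (X 1) = 0 \<and> l (Psi 0) = 0"
    "l (Phi 1 2) \<noteq> 0 \<Longrightarrow> l (X 1) \<le> 1"
    "l (Psi 1) \<le> 1"
proof -
  note dvd = not_mon_dvd_standard [OF std]
  have A: "l (X (nat i)) = 0 \<or> l (Psi (nat j)) = 0" if "i \<in> {1, 2, 3}" "j \<in> {0, 1}" for i j
  proof -
    have "polyA a d i 1 j \<in> (GB a d 1 :: 'k mpoly set)"
      using that by (intro polyA_in_GB) auto
    from dvd [OF lead_A_1 [OF m0(1) that] this, unfolded mon_dvd_monE] show ?thesis
      by (auto simp: l_def)
  qed
  show "l (X 1) = 0 \<and> l (X 2) = 0 \<and> l (X 3) = 0" if "l (Psi 0) \<noteq> 0 \<or> l (Psi 1) \<noteq> 0"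
    using that A [of 1 0] A [of 2 0] A [of 3 0] A [of 1 1] A [of 2 1] A [of 3 1] by auto
  have B: "\<not> mon_dvd (monE [X (nat i), X (nat j), Psi 2]) m" if "(i, j) \<in> {(1, 1), (1, 2), (2, 2)}" for i j
  proof -
    have "polyB a d 1 i j \<in> (GB a d 1 :: 'k mpoly set)"
      using that by (intro polyB_in_GB) auto
    from dvd [OF lead_B_1 [OF m0(1) that] this] show ?thesis .
  qed
  show "l (X 1) + l (X 2) \<le> 1" if "l (Psi 2) \<noteq> 0"
    using that B [of 1 1, unfolded mon_dvd_monE] B [of 1 2, unfolded mon_dvd_monE] B [of 2 2, unfolded mon_dvd_monE]
    by (auto simp: l_def)
  note L = dvd [OF lead_L_1 [OF m0(1)] polyL_in_GB, unfolded mon_dvd_monE]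
  have "polyD \<in> (GB a d 1 :: 'k mpoly set)" "polyQ11 \<in> (GB a d 1 :: 'k mpoly set)"
      "polyQ12 a d \<in> (GB a d 1 :: 'k mpoly set)"
    by (auto simp: GB_def)
  note DQ = dvd [OF lead_D_1 [OF m0(1)] this(1)] dvd [OF lead_Q11 [OF m0(1)] this(2)]
    dvd [OF lead_Q12 [OF m0] this(3)]
  note DQ = DQ [unfolded mon_dvd_monE]
  show "l (X 0) = 0 \<and> l (X 1) = 0 \<and> l (Psi 0) = 0" if "l (Phi 2 2) \<noteq> 0"
    using that L [of 0] L [of 1] DQ(2) by (auto simp: l_def)
  show "l (X 1) \<le> 1" if "l (Phi 1 2) \<noteq> 0" using that DQ(1) by (auto simp: l_def)
  show "l (Psi 1) \<le> 1" using DQ(3) by (auto simp: l_def)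
qed

lemma standard_2:
  fixes m0 a d :: nat and m :: "var \<Rightarrow>\<^sub>0 nat"
  defines "l \<equiv> Poly_Mapping.lookup m"
  assumes m0: "m0 = 3 * a + 2" "1 \<le> a" and std: "standard (wsE m0 d a 2) (GB a d 2 :: 'k::field mpoly set) m"
  shows "l (Psi 0) \<noteq> 0 \<Longrightarrow> l (X 1) = 0 \<and> l (X 2) = 0 \<and> l (X 3) = 0"
    "l (Psi 1) \<noteq> 0 \<Longrightarrow> l (X 1) + l (X 2) \<le> 1"
    "l (Phi 2 2) \<noteq> 0 \<Longrightarrow> l (X 0) = 0 \<and> l (X 1) = 0 \<and> l (Psi 0) \<le> 1"
    "l (Phi 1 2) \<noteq> 0 \<Longrightarrow> l (X 1) \<le> 1"
proof -
  note dvd = not_mon_dvd_standard [OF std]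
  have A: "l (X (nat i)) = 0 \<or> l (Psi 0) = 0" if "i \<in> {1, 2, 3}" for i
  proof -
    have "polyA a d i 2 0 \<in> (GB a d 2 :: 'k mpoly set)"
      using that by (intro polyA_in_GB) auto
    from dvd [OF lead_A_2 [OF m0(1) that] this, unfolded mon_dvd_monE] show ?thesis
      by (auto simp: l_def)
  qed
  show "l (X 1) = 0 \<and> l (X 2) = 0 \<and> l (X 3) = 0" if "l (Psi 0) \<noteq> 0"
    using that A [of 1] A [of 2] A [of 3] by auto
  have B: "\<not> mon_dvd (monE [X (nat i), X (nat j), Psi 1]) m" if "(i, j) \<in> {(1, 1), (1, 2), (2, 2)}" for i j
  proof -
    have "polyB a d 2 i j \<in> (GB a d 2 :: 'k mpoly set)"
      using that by (intro polyB_in_GB) auto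
    from dvd [OF lead_B_2 [OF m0(1) that] this] show ?thesis .
  qed
  show "l (X 1) + l (X 2) \<le> 1" if "l (Psi 1) \<noteq> 0"
    using that B [of 1 1, unfolded mon_dvd_monE] B [of 1 2, unfolded mon_dvd_monE] B [of 2 2, unfolded mon_dvd_monE]
    by (auto simp: l_def)
  note L = dvd [OF lead_L_2 [OF m0(1)] polyL_in_GB, unfolded mon_dvd_monE]
  have "polyD \<in> (GB a d 2 :: 'k mpoly set)" "polyQ21 a d \<in> (GB a d 2 :: 'k mpoly set)"
    by (auto simp: GB_def)
  note DQ = dvd [OF lead_D_2 [OF m0(1)] this(1)] dvd [OF lead_Q21 [OF m0] this(2)]
  note DQ = DQ [unfolded mon_dvd_monE]
  show "l (X 0) = 0 \<and> l (X 1) = 0 \<and> l (Psi 0) \<le> 1" if "l (Phi 2 2) \<noteq> 0"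
    using that L [of 0] L [of 1] DQ(2) by (auto simp: l_def)
  show "l (X 1) \<le> 1" if "l (Phi 1 2) \<noteq> 0" using that DQ(1) by (auto simp: l_def)
qed

section \<open>Leading terms in coordinates adapted to the cone\<close>

text \<open>The coordinates \<open>x, v, y, z\<close> (written \<open>X 0, X 1, X 2, X 3\<close>) in which \<open>\<phi>(1,1) = x z\<close>
  and \<open>\<phi>(1,2) = x y\<close>: the twisted cubic cone becomes \<open>y = z = 0\<close>.\<close>

definition normal_coords :: "var \<Rightarrow> 'k::comm_ring_1 mpoly" where
  "normal_coords v = (case v of
      X i \<Rightarrow> [Var (X 0), Var (X 0) * Var (X 1), Var (X 0) * Var (X 1) ^ 2 - Var (X 3),
          Var (X 0) * Var (X 1) ^ 3 - Var (X 1) * Var (X 3) - Var (X 2)] ! i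
    | _ \<Rightarrow> Var v)"

text \<open>The most significant weight, \<open>t\<close>-degree minus \<open>(y, z)\<close>-degree, equals on the leading monomial of
  an image the number of factors \<open>\<Psi>(b,j)\<close> of the original monomial.\<close>

definition ws_normal :: "(var \<Rightarrow> int) list" where
  "ws_normal = [\<lambda>v. of_bool (v = X 2), \<lambda>v. of_bool (v = X 1), \<lambda>v. of_bool (v = X 0),
     \<lambda>v. of_bool (v = T), \<lambda>v. of_bool (v = T) - of_bool (v = X 2) - of_bool (v = X 3)]"

text \<open>For each variable, the \<open>ws_normal\<close> weights of the leading monomial of its
  image: x v^i for X_i, x^(N+1) v^j t for Psi(b,j), and x z t, x y t, x v^2 z t for the Phi's.
  \<open>N\<close> stands for \<open>a + d\<close>.\<close>

definition us_normal :: "nat \<Rightarrow> (var \<Rightarrow> int) list" where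
  "us_normal N = [\<lambda>v. of_bool (v = Phi 1 2),
     \<lambda>v. (case v of X i \<Rightarrow> int i | Psi j \<Rightarrow> int j | Phi i j \<Rightarrow> 2 * of_bool (i = 2 \<and> j = 2) | T \<Rightarrow> 0),
     \<lambda>v. (case v of Psi j \<Rightarrow> int N + 1 | T \<Rightarrow> 0 | _ \<Rightarrow> 1),
     \<lambda>v. (case v of X i \<Rightarrow> 0 | _ \<Rightarrow> 1),
     \<lambda>v. (case v of Psi j \<Rightarrow> 1 | _ \<Rightarrow> 0)]"

lemma has_leadI: "is_lead ws p e \<Longrightarrow> code ws e = c \<Longrightarrow> has_lead ws p c"
  by (auto simp: has_lead_def)

lemma pCons_less_0_iff: "pCons a p < 0 \<longleftrightarrow> p < 0 \<or> (p = 0 \<and> a < 0)"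
  for p :: "int poly"
  using less_pCons_iff [of a p 0 0] by simp

lemmas ws_normal_simps = pCons_less_0_iff code_def vcode_def ws_normal_def us_normal_def wt_add less_pCons_iff

lemma has_lead_normal_X:
  fixes N :: nat
  assumes "i \<le> 3"
  shows "has_lead ws_normal (normal_coords (X i) :: 'k::idom mpoly) (vcode (us_normal N) (X i))"
proof -
  have 0: "has_lead ws_normal (normal_coords (X 0) :: 'k mpoly) (vcode (us_normal N) (X 0))"
    using has_lead_single [of "1 :: 'k" ws_normal "Poly_Mapping.single (X 0) 1"]
    by (simp add: normal_coords_def Var_def ws_normal_simps)
  have 1: "has_lead ws_normal (normal_coords (X 1) :: 'k mpoly) (vcode (us_normal N) (X 1))"
    by (rule has_leadI [where e = "monE [X 0, X 1]"]; simp add: normal_coords_def Var_monomial flip: One_nat_def)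
       ((intro lead_rules below_single disjI2)?; simp add: ws_normal_simps flip: One_nat_def)+
  have 2: "has_lead ws_normal (normal_coords (X 2) :: 'k mpoly) (vcode (us_normal N) (X 2))"
    by (rule has_leadI [where e = "monE [X 0, X 1, X 1]"]; simp add: single_twice normal_coords_def Var_monomial flip: One_nat_def)
       ((intro lead_rules below_single disjI2)?; simp add: ws_normal_simps flip: One_nat_def)+
  have 3: "has_lead ws_normal (normal_coords (X 3) :: 'k mpoly) (vcode (us_normal N) (X 3))"
    by (rule has_leadI [where e = "monE [X 0] + Poly_Mapping.single (X 1) 3"]; simp add: normal_coords_def Var_monomial flip: One_nat_def)
       ((intro lead_rules below_single disjI2)?; simp add: ws_normal_simps flip: One_nat_def)+
  have "i = 0 \<or> i = 1 \<or> i = 2 \<or> i = 3" using assms by auto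
  then show ?thesis using 0 1 2 3 by blast
qed


lemma subst_normal_Xv [simp]: "0 \<le> i \<Longrightarrow> i \<le> 3 \<Longrightarrow> subst normal_coords (Xv i) = normal_coords (X (nat i))"
  by (simp add: Xv_def)

lemma subst_normal_T [simp]: "normal_coords T = Var T"
  by (simp add: normal_coords_def)

lemma has_lead_Var: "has_lead ws (Var v :: 'k::idom mpoly) (vcode ws v)"
  using has_lead_single [of "1 :: 'k" ws "Poly_Mapping.single v 1"] by (simp add: Var_def code_single)

text \<open>Both products have (y,z)-degree 0 in their leading terms, so the x-degree decides: a + d
  + 1 against a + 1. This is where \<open>0 < d\<close> enters.\<close>

lemma has_lead_normal_Psi:
  assumes "0 < d" "b + j \<le> 3"
  shows "has_lead ws_normal (subst normal_coords (phi_map a d b (Psi j)) :: 'k::idom mpoly)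
    (vcode (us_normal (a + d)) (Psi j))"
proof -
  let ?U = "vcode (us_normal (a + d))"
  let ?X = "\<lambda>i. normal_coords (X i) :: 'k mpoly"
  let ?c = "vcode ws_normal T"
  have big: "has_lead ws_normal (?X j * ?X 0 ^ (a + d) * Var T) (?U (X j) + of_nat (a + d) * ?U (X 0) + ?c)"
    using assms by (intro has_lead_mult has_lead_power has_lead_normal_X has_lead_Var) auto
  have small: "has_lead ws_normal (?X (b + j) * ?X 3 ^ a * Var T) (?U (X (b + j)) + of_nat a * ?U (X 3) + ?c)"
    using assms by (intro has_lead_mult has_lead_power has_lead_normal_X has_lead_Var) auto
  have "?U (X (b + j)) + of_nat a * ?U (X 3) + ?c < ?U (X j) + of_nat (a + d) * ?U (X 0) + ?c"
    using assms(1) by (simp add: ws_normal_simps of_nat_poly)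
  then have "has_lead ws_normal (?X j * ?X 0 ^ (a + d) * Var T - ?X (b + j) * ?X 3 ^ a * Var T)
      (?U (X j) + of_nat (a + d) * ?U (X 0) + ?c)"
    using has_lead_add [OF big below_uminus [OF has_lead_below [OF small]]] by simp
  from has_lead_uminus [OF this]
  have "has_lead ws_normal ((?X (b + j) * ?X 3 ^ a - ?X j * ?X 0 ^ (a + d)) * Var T)
      (?U (X j) + of_nat (a + d) * ?U (X 0) + ?c)"
    by (simp add: algebra_simps)
  moreover have "?U (X j) + of_nat (a + d) * ?U (X 0) + ?c = ?U (Psi j)"
    by (simp add: ws_normal_simps of_nat_poly)
  moreover have "subst normal_coords (phi_map a d b (Psi j)) = (?X (b + j) * ?X 3 ^ a - ?X j * ?X 0 ^ (a + d)) * Var T"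
    using assms by (simp add: phi_map_def psi_small_def subst_simps nat_add_distrib)
  ultimately show ?thesis by simp
qed

text \<open>For Phi(2,2), the term z^2 t loses by its (y,z)-degree, and x v^2 z t beats x v y t
  because v is more significant than y in \<open>ws_normal\<close>.\<close>

lemma has_lead_normal_Phi:
  assumes "(i, j) \<in> {(1, 1), (1, 2), (2, 2)}"
  shows "has_lead ws_normal (subst normal_coords (phi_map a d b (Phi i j)) :: 'k::idom mpoly)
    (vcode (us_normal N) (Phi i j))"
proof -
  define x v y z t where "x = (Var (X 0) :: 'k mpoly)" and "v = (Var (X 1) :: 'k mpoly)"
    and "y = (Var (X 2) :: 'k mpoly)" and "z = (Var (X 3) :: 'k mpoly)" and "t = (Var T :: 'k mpoly)"
  note defs = x_def v_def y_def z_def t_def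
  have coords: "normal_coords (X 0) = x" "normal_coords (X 1) = x * v" "normal_coords (X 2) = x * v ^ 2 - z"
      "normal_coords (X 3) = x * v ^ 3 - v * z - y"
    by (simp_all add: normal_coords_def defs)
  have 11: "subst normal_coords (phi_map a d b (Phi 1 1)) = x * z * t"
    by (simp add: phi_map_def phi_small_def subst_simps coords flip: One_nat_def)
       (simp add: t_def algebra_simps power2_eq_square)
  have 12: "subst normal_coords (phi_map a d b (Phi 1 2)) = x * y * t"
    by (simp add: phi_map_def phi_small_def subst_simps coords flip: One_nat_def)
       (simp add: t_def algebra_simps power2_eq_square power3_eq_cube)
  have 22: "subst normal_coords (phi_map a d b (Phi 2 2)) = - (x * v ^ 2 * z * t - x * v * y * t - z ^ 2 * t)"
    by (simp add: phi_map_def phi_small_def subst_simps coords flip: One_nat_def)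
       (simp add: t_def algebra_simps power2_eq_square power3_eq_cube)
  have "has_lead ws_normal (x * z * t) (vcode (us_normal N) (Phi 1 1))"
    using has_lead_mult [OF has_lead_mult [OF has_lead_Var has_lead_Var] has_lead_Var, of ws_normal "X 0" "X 3" T]
    by (simp add: defs ws_normal_simps)
  moreover have "has_lead ws_normal (x * y * t) (vcode (us_normal N) (Phi 1 2))"
    using has_lead_mult [OF has_lead_mult [OF has_lead_Var has_lead_Var] has_lead_Var, of ws_normal "X 0" "X 2" T]
    by (simp add: defs ws_normal_simps)
  moreover have "has_lead ws_normal (x * v ^ 2 * z * t - x * v * y * t - z ^ 2 * t) (vcode (us_normal N) (Phi 2 2))"
    by (rule has_leadI [where e = "monE [X 0, X 1, X 1, X 3, T]"]; simp add: single_twice defs Var_monomial add.assoc flip: One_nat_def)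
       ((intro lead_rules below_single disjI2)?; simp add: ws_normal_simps flip: One_nat_def)+
  then have "has_lead ws_normal (- (x * v ^ 2 * z * t - x * v * y * t - z ^ 2 * t)) (vcode (us_normal N) (Phi 2 2))"
    by (rule has_lead_uminus)
  ultimately show ?thesis
    using assms by (auto simp: 11 12 22 simp flip: One_nat_def simp del: minus_diff_eq)
qed

section \<open>Leading terms in the lexicographic order\<close>

definition ws_lex :: "(var \<Rightarrow> int) list" where
  "ws_lex = map (\<lambda>u v. of_bool (v = u)) [X 2, X 0, X 1, X 3, T]"

definition us_lex :: "(var \<Rightarrow> int) list" where
  "us_lex = [\<lambda>v. of_bool (v = X 2), \<lambda>v. of_bool (v = X 0) + of_bool (v = Phi 1 2),
     \<lambda>v. of_bool (v = X 1) + 2 * of_bool (v = Phi 1 1) + of_bool (v = Phi 2 2),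
     \<lambda>v. of_bool (v = X 3) + of_bool (v = Phi 1 2) + of_bool (v = Phi 2 2),
     \<lambda>v. of_bool (v = Phi 1 1) + of_bool (v = Phi 1 2) + of_bool (v = Phi 2 2)]"

lemmas ws_lex_simps = pCons_less_0_iff code_def vcode_def ws_lex_def us_lex_def wt_add less_pCons_iff

lemma has_lead_lex:
  assumes "v \<in> vars_R b" "v \<notin> range Psi"
  shows "has_lead ws_lex (phi_map a d b v :: 'k::idom mpoly) (vcode us_lex v)"
proof -
  have 11: "has_lead ws_lex (phi_map a d b (Phi 1 1) :: 'k mpoly) (vcode us_lex (Phi 1 1))"
    by (rule has_leadI [where e = "monE [X 1, X 1, T]"];
        simp add: single_twice phi_map_def phi_small_def Xv_def left_diff_distrib Var_monomial add.assoc flip: One_nat_def)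
       ((intro lead_rules below_single disjI2)?; simp add: ws_lex_simps flip: One_nat_def)+
  have "has_lead ws_lex (- phi_map a d b (Phi 1 2) :: 'k mpoly) (vcode us_lex (Phi 1 2))"
    by (rule has_leadI [where e = "monE [X 3, X 0, T]"];
        simp add: single_twice phi_map_def phi_small_def Xv_def left_diff_distrib Var_monomial add.assoc flip: One_nat_def)
       ((intro lead_rules below_single disjI2)?; simp add: ws_lex_simps flip: One_nat_def)+
  then have 12: "has_lead ws_lex (phi_map a d b (Phi 1 2) :: 'k mpoly) (vcode us_lex (Phi 1 2))"
    using has_lead_uminus by fastforce
  have "has_lead ws_lex (- phi_map a d b (Phi 2 2) :: 'k mpoly) (vcode us_lex (Phi 2 2))"
    by (rule has_leadI [where e = "monE [X 1, X 3, T]"];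
        simp add: single_twice phi_map_def phi_small_def Xv_def left_diff_distrib Var_monomial add.assoc flip: One_nat_def)
       ((intro lead_rules below_single disjI2)?; simp add: ws_lex_simps flip: One_nat_def)+
  then have 22: "has_lead ws_lex (phi_map a d b (Phi 2 2) :: 'k mpoly) (vcode us_lex (Phi 2 2))"
    using has_lead_uminus by fastforce
  have X: "has_lead ws_lex (phi_map a d b (X i) :: 'k mpoly) (vcode us_lex (X i))" if "i \<in> {0, 1, 2, 3}" for i
    using that has_lead_Var [of ws_lex "X i"] by (auto simp: phi_map_def ws_lex_simps)
  show ?thesis
    using assms X [of 0] X [of 1] X [of 2] X [of 3] 11 12 22 by (auto simp: vars_R_def)
qed


section \<open>Standard monomials are separated by their leading codes\<close>

lemma vars_R_1: "vars_R 1 = {X 0, X 1, X 2, X 3, Psi 0, Psi 1, Psi 2, Phi 2 2, Phi 1 2, Phi 1 1}"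
proof -
  have "{Psi j | j. j \<le> 3 - 1} = {Psi 0, Psi 1, Psi 2}" by (auto simp: numeral_2_eq_2 le_Suc_eq)
  then show ?thesis unfolding vars_R_def by auto
qed

lemma vars_R_2: "vars_R 2 = {X 0, X 1, X 2, X 3, Psi 0, Psi 1, Phi 2 2, Phi 1 2, Phi 1 1}"
proof -
  have "{Psi j | j. j \<le> 3 - 2} = {Psi 0, Psi 1}" by (auto simp: le_Suc_eq)
  then show ?thesis unfolding vars_R_def by auto
qed

lemma monomial_eqI:
  assumes "Poly_Mapping.keys m \<subseteq> V" "Poly_Mapping.keys n \<subseteq> V"
    and "\<And>v. v \<in> V \<Longrightarrow> Poly_Mapping.lookup m v = Poly_Mapping.lookup n v"
  shows "m = n"
  using assms by (intro poly_mapping_eqI) (metis in_keys_iff subsetD)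

text \<open>A factor \<open>Psi\<close> is what activates the restrictions of A and B on the X-part.
  It is demanded of \<open>m\<close> only, since the top weight counts these factors and so passes
  to \<open>n\<close>.\<close>

lemma us_normal_inj_1:
  assumes m0: "m0 = 3 * a + 1" "1 \<le> a"
    and m: "Poly_Mapping.keys m \<subseteq> vars_R 1" "standard (wsE m0 d a 1) (GB a d 1 :: 'k::field mpoly set) m"
    and n: "Poly_Mapping.keys n \<subseteq> vars_R 1" "standard (wsE m0 d a 1) (GB a d 1 :: 'k::field mpoly set) n"
    and eq: "code (us_normal N) m = code (us_normal N) n"
    and Psi: "Poly_Mapping.lookup m (Psi j) \<noteq> 0" "Psi j \<in> vars_R 1"
  shows "m = n"
proof -
  let ?l = "\<lambda>v. int (Poly_Mapping.lookup m v)" and ?k = "\<lambda>v. int (Poly_Mapping.lookup n v)"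
  note sm = standard_1 [OF m0 m(2)] and sn = standard_1 [OF m0 n(2)]
  have wt: "wt w p = (\<Sum>v\<in>vars_R 1. w v * int (Poly_Mapping.lookup p v))" if "p \<in> {m, n}" for w p
    using that m n by (auto intro!: wt_superset simp: finite_vars_R)
  have E: "?l (Psi 0) + ?l (Psi 1) + ?l (Psi 2) = ?k (Psi 0) + ?k (Psi 1) + ?k (Psi 2)"
    "?l (Phi 2 2) + ?l (Phi 1 2) + ?l (Phi 1 1) = ?k (Phi 2 2) + ?k (Phi 1 2) + ?k (Phi 1 1)"
    "?l (Phi 1 2) = ?k (Phi 1 2)"
    "?l (X 0) + ?l (X 1) + ?l (X 2) + ?l (X 3) = ?k (X 0) + ?k (X 1) + ?k (X 2) + ?k (X 3)"
    "?l (X 1) + 2 * ?l (X 2) + 3 * ?l (X 3) + ?l (Psi 1) + 2 * ?l (Psi 2) + 2 * ?l (Phi 2 2) =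
     ?k (X 1) + 2 * ?k (X 2) + 3 * ?k (X 3) + ?k (Psi 1) + 2 * ?k (Psi 2) + 2 * ?k (Phi 2 2)"
  proof -
    note eq' = eq [unfolded code_def us_normal_def, simplified wt [OF insertI1] wt [OF insertI2 [OF singletonI]] vars_R_1,
        simplified distrib_right, simplified, folded One_nat_def]
    show c: "?l (Psi 0) + ?l (Psi 1) + ?l (Psi 2) = ?k (Psi 0) + ?k (Psi 1) + ?k (Psi 2)"
      using eq' by (elim conjE) linarith
    \<comment> \<open>The x-degree contains the product of \<open>N\<close> with the number of
      \<open>Psi\<close> factors, which linear arithmetic cannot cancel unaided.\<close>
    then have c': "int N * (?l (Psi 0) + ?l (Psi 1) + ?l (Psi 2)) = int N * (?k (Psi 0) + ?k (Psi 1) + ?k (Psi 2))"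
      by simp
    note c' = c' [unfolded distrib_left]
    show f: "?l (Phi 2 2) + ?l (Phi 1 2) + ?l (Phi 1 1) = ?k (Phi 2 2) + ?k (Phi 1 2) + ?k (Phi 1 1)"
      using eq' c by (elim conjE) linarith
    show "?l (Phi 1 2) = ?k (Phi 1 2)" using eq' by simp
    show "?l (X 0) + ?l (X 1) + ?l (X 2) + ?l (X 3) = ?k (X 0) + ?k (X 1) + ?k (X 2) + ?k (X 3)"
      using eq' c c' f by (elim conjE) (simp add: distrib_right)
    show "?l (X 1) + 2 * ?l (X 2) + 3 * ?l (X 3) + ?l (Psi 1) + 2 * ?l (Psi 2) + 2 * ?l (Phi 2 2) =
     ?k (X 1) + 2 * ?k (X 2) + 3 * ?k (X 3) + ?k (Psi 1) + 2 * ?k (Psi 2) + 2 * ?k (Phi 2 2)"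
      using eq' by (elim conjE) linarith
  qed
  have c: "?l (Psi 0) + ?l (Psi 1) + ?l (Psi 2) \<ge> 1"
    using Psi [unfolded vars_R_1] by auto
  \<comment> \<open>The number c of \<open>Psi\<close> factors being common, their v-degree is 2 c -
    u with u the exponent of Psi(1,1) plus twice that of Psi(1,0).\<close>
  have "?l (X 0) = ?k (X 0) \<and> ?l (X 1) = ?k (X 1) \<and> ?l (X 2) = ?k (X 2) \<and> ?l (X 3) = ?k (X 3) \<and>
      2 * ?l (Psi 0) + ?l (Psi 1) = 2 * ?k (Psi 0) + ?k (Psi 1) \<and> ?l (Phi 2 2) = ?k (Phi 2 2)"
  proof (rule weights_determine_exponents)
    show "2 * ?l (Psi 0) + ?l (Psi 1) = 0 \<longrightarrow> ?l (X 1) + ?l (X 2) \<le> 1" using sm(2) c by force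
    show "2 * ?k (Psi 0) + ?k (Psi 1) = 0 \<longrightarrow> ?k (X 1) + ?k (X 2) \<le> 1" using sn(2) c E(1) by force
    show "2 * ?l (Psi 0) + ?l (Psi 1) \<noteq> 0 \<longrightarrow> ?l (X 1) = 0 \<and> ?l (X 2) = 0 \<and> ?l (X 3) = 0" using sm(1) by force
    show "2 * ?k (Psi 0) + ?k (Psi 1) \<noteq> 0 \<longrightarrow> ?k (X 1) = 0 \<and> ?k (X 2) = 0 \<and> ?k (X 3) = 0" using sn(1) by force
    show "?l (Phi 2 2) \<noteq> 0 \<longrightarrow> ?l (X 0) = 0 \<and> ?l (X 1) = 0 \<and> 2 * ?l (Psi 0) + ?l (Psi 1) \<le> 1" using sm(3,5) by force
    show "?k (Phi 2 2) \<noteq> 0 \<longrightarrow> ?k (X 0) = 0 \<and> ?k (X 1) = 0 \<and> 2 * ?k (Psi 0) + ?k (Psi 1) \<le> 1" using sn(3,5) by force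
  qed (use E in auto)
  \<comment> \<open>Q(1,2) bounds both exponents of Psi(1,1) by 1, so the parity of u determines
    them.\<close>
  moreover from this have "?l (Psi 1) = ?k (Psi 1)"
    using sm(5) sn(5) by presburger
  ultimately show ?thesis
    using E by (intro monomial_eqI [OF m(1) [unfolded vars_R_1] n(1) [unfolded vars_R_1]]) auto
qed

lemma us_normal_inj_2:
  assumes m0: "m0 = 3 * a + 2" "1 \<le> a"
    and m: "Poly_Mapping.keys m \<subseteq> vars_R 2" "standard (wsE m0 d a 2) (GB a d 2 :: 'k::field mpoly set) m"
    and n: "Poly_Mapping.keys n \<subseteq> vars_R 2" "standard (wsE m0 d a 2) (GB a d 2 :: 'k::field mpoly set) n"
    and eq: "code (us_normal N) m = code (us_normal N) n"
    and Psi: "Poly_Mapping.lookup m (Psi j) \<noteq> 0" "Psi j \<in> vars_R 2"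
  shows "m = n"
proof -
  let ?l = "\<lambda>v. int (Poly_Mapping.lookup m v)" and ?k = "\<lambda>v. int (Poly_Mapping.lookup n v)"
  note sm = standard_2 [OF m0 m(2)] and sn = standard_2 [OF m0 n(2)]
  have wt: "wt w p = (\<Sum>v\<in>vars_R 2. w v * int (Poly_Mapping.lookup p v))" if "p \<in> {m, n}" for w p
    using that m n by (auto intro!: wt_superset simp: finite_vars_R)
  have E: "?l (Psi 0) + ?l (Psi 1) = ?k (Psi 0) + ?k (Psi 1)"
    "?l (Phi 2 2) + ?l (Phi 1 2) + ?l (Phi 1 1) = ?k (Phi 2 2) + ?k (Phi 1 2) + ?k (Phi 1 1)"
    "?l (Phi 1 2) = ?k (Phi 1 2)"
    "?l (X 0) + ?l (X 1) + ?l (X 2) + ?l (X 3) = ?k (X 0) + ?k (X 1) + ?k (X 2) + ?k (X 3)"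
    "?l (X 1) + 2 * ?l (X 2) + 3 * ?l (X 3) + ?l (Psi 1) + 2 * ?l (Phi 2 2) =
     ?k (X 1) + 2 * ?k (X 2) + 3 * ?k (X 3) + ?k (Psi 1) + 2 * ?k (Phi 2 2)"
  proof -
    note eq' = eq [unfolded code_def us_normal_def, simplified wt [OF insertI1] wt [OF insertI2 [OF singletonI]] vars_R_2,
        simplified distrib_right, simplified, folded One_nat_def]
    show c: "?l (Psi 0) + ?l (Psi 1) = ?k (Psi 0) + ?k (Psi 1)"
      using eq' by (elim conjE) linarith
    then have c': "int N * (?l (Psi 0) + ?l (Psi 1)) = int N * (?k (Psi 0) + ?k (Psi 1))"
      by simp
    note c' = c' [unfolded distrib_left]
    show f: "?l (Phi 2 2) + ?l (Phi 1 2) + ?l (Phi 1 1) = ?k (Phi 2 2) + ?k (Phi 1 2) + ?k (Phi 1 1)"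
      using eq' c by (elim conjE) linarith
    show "?l (Phi 1 2) = ?k (Phi 1 2)" using eq' by simp
    show "?l (X 0) + ?l (X 1) + ?l (X 2) + ?l (X 3) = ?k (X 0) + ?k (X 1) + ?k (X 2) + ?k (X 3)"
      using eq' c c' f by (elim conjE) (simp add: distrib_right)
    show "?l (X 1) + 2 * ?l (X 2) + 3 * ?l (X 3) + ?l (Psi 1) + 2 * ?l (Phi 2 2) =
     ?k (X 1) + 2 * ?k (X 2) + 3 * ?k (X 3) + ?k (Psi 1) + 2 * ?k (Phi 2 2)"
      using eq' by (elim conjE) linarith
  qed
  have c: "?l (Psi 0) + ?l (Psi 1) \<ge> 1"
    using Psi [unfolded vars_R_2] by auto
  \<comment> \<open>For b = 2 the v-degree of the \<open>Psi\<close> factors is their number minus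
    the exponent of Psi(2,0), which therefore serves as u.\<close>
  have "?l (X 0) = ?k (X 0) \<and> ?l (X 1) = ?k (X 1) \<and> ?l (X 2) = ?k (X 2) \<and> ?l (X 3) = ?k (X 3) \<and>
      ?l (Psi 0) = ?k (Psi 0) \<and> ?l (Phi 2 2) = ?k (Phi 2 2)"
  proof (rule weights_determine_exponents)
    show "?l (Psi 0) = 0 \<longrightarrow> ?l (X 1) + ?l (X 2) \<le> 1" using sm(2) c by force
    show "?k (Psi 0) = 0 \<longrightarrow> ?k (X 1) + ?k (X 2) \<le> 1" using sn(2) c E(1) by force
    show "?l (Psi 0) \<noteq> 0 \<longrightarrow> ?l (X 1) = 0 \<and> ?l (X 2) = 0 \<and> ?l (X 3) = 0" using sm(1) by force
    show "?k (Psi 0) \<noteq> 0 \<longrightarrow> ?k (X 1) = 0 \<and> ?k (X 2) = 0 \<and> ?k (X 3) = 0" using sn(1) by force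
    show "?l (Phi 2 2) \<noteq> 0 \<longrightarrow> ?l (X 0) = 0 \<and> ?l (X 1) = 0 \<and> ?l (Psi 0) \<le> 1" using sm(3) by force
    show "?k (Phi 2 2) \<noteq> 0 \<longrightarrow> ?k (X 0) = 0 \<and> ?k (X 1) = 0 \<and> ?k (Psi 0) \<le> 1" using sn(3) by force
  qed (use E in auto)
  then show ?thesis
    using E by (intro monomial_eqI [OF m(1) [unfolded vars_R_2] n(1) [unfolded vars_R_2]]) auto
qed


lemma standard_D_L:
  assumes "b \<in> {1, 2}" "m0 = 3 * a + b" "1 \<le> a" "standard (wsE m0 d a b) (GB a d b :: 'k::field mpoly set) m"
  shows "Poly_Mapping.lookup m (Phi 2 2) \<noteq> 0 \<Longrightarrow>
      Poly_Mapping.lookup m (X 0) = 0 \<and> Poly_Mapping.lookup m (X 1) = 0"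
    "Poly_Mapping.lookup m (Phi 1 2) \<noteq> 0 \<Longrightarrow> Poly_Mapping.lookup m (X 1) \<le> 1"
  using assms standard_1 [of m0 a d m] standard_2 [of m0 a d m] by blast+

lemma us_lex_inj:
  assumes b: "b \<in> {1, 2}" "m0 = 3 * a + b" "1 \<le> a"
    and m: "Poly_Mapping.keys m \<subseteq> vars_R b - range Psi" "standard (wsE m0 d a b) (GB a d b :: 'k::field mpoly set) m"
    and n: "Poly_Mapping.keys n \<subseteq> vars_R b - range Psi" "standard (wsE m0 d a b) (GB a d b :: 'k::field mpoly set) n"
    and eq: "code us_lex m = code us_lex n"
  shows "m = n"
proof -
  let ?l = "\<lambda>v. int (Poly_Mapping.lookup m v)" and ?k = "\<lambda>v. int (Poly_Mapping.lookup n v)"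
  let ?V = "{X 0, X 1, X 2, X 3, Phi 2 2, Phi 1 2, Phi 1 1}"
  have V: "vars_R b - range Psi \<subseteq> ?V" by (auto simp: vars_R_def)
  note sm = standard_D_L [OF b m(2)] and sn = standard_D_L [OF b n(2)]
  have wt: "wt w p = (\<Sum>v\<in>?V. w v * int (Poly_Mapping.lookup p v))" if "p \<in> {m, n}" for w p
    using that m n V by (intro wt_superset) auto
  note eq' = eq [unfolded code_def us_lex_def,
      simplified wt [OF insertI1] wt [OF insertI2 [OF singletonI]], simplified, folded One_nat_def]
  have "?l (X 0) = ?k (X 0) \<and> ?l (X 1) = ?k (X 1) \<and> ?l (X 2) = ?k (X 2) \<and> ?l (X 3) = ?k (X 3) \<and>
      ?l (Phi 2 2) = ?k (Phi 2 2) \<and> ?l (Phi 1 2) = ?k (Phi 1 2) \<and> ?l (Phi 1 1) = ?k (Phi 1 1)"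
  proof (rule weights_determine_Psi_free_exponents)
    show "?l (Phi 2 2) \<noteq> 0 \<longrightarrow> ?l (X 0) = 0 \<and> ?l (X 1) = 0" using sm(1) by force
    show "?k (Phi 2 2) \<noteq> 0 \<longrightarrow> ?k (X 0) = 0 \<and> ?k (X 1) = 0" using sn(1) by force
    show "?l (Phi 1 2) \<noteq> 0 \<longrightarrow> ?l (X 1) \<le> 1" using sm(2) by force
    show "?k (Phi 1 2) \<noteq> 0 \<longrightarrow> ?k (X 1) \<le> 1" using sn(2) by force
  qed (use eq' in \<open>simp_all flip: One_nat_def\<close>)
  then show ?thesis
    using m(1) n(1) V by (intro monomial_eqI [of m ?V n]) auto
qed

section \<open>Linear independence and the conclusion\<close>

lemma has_lead_normal:
  assumes "0 < d" "b \<le> 3" "v \<in> vars_R b"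
  shows "has_lead ws_normal (subst normal_coords (phi_map a d b v) :: 'k::idom mpoly) (vcode (us_normal (a + d)) v)"
proof -
  have X: "has_lead ws_normal (subst normal_coords (phi_map a d b (X i)) :: 'k mpoly) (vcode (us_normal (a + d)) (X i))"
    if "i \<le> 3" for i
    using has_lead_normal_X [OF that, of "a + d", where 'k = 'k] by (simp add: phi_map_def)
  show ?thesis
    using assms X [of 0] X [of 1] X [of 2] X [of 3] has_lead_normal_Psi [OF assms(1), of b _ a, where 'k = 'k]
      has_lead_normal_Phi [of 1 1 a d b "a + d", where 'k = 'k] has_lead_normal_Phi [of 1 2 a d b "a + d", where 'k = 'k]
      has_lead_normal_Phi [of 2 2 a d b "a + d", where 'k = 'k]
    unfolding vars_R_def by force
qed

lemma standard_independent:
  fixes r :: "'k::field mpoly"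
  assumes b: "b \<in> {1, 2}" "m0 = 3 * a + b" "1 \<le> a" and d: "0 < d"
    and r: "\<And>m. m \<in> Poly_Mapping.keys r \<Longrightarrow>
      Poly_Mapping.keys m \<subseteq> vars_R b \<and> standard (wsE m0 d a b) (GB a d b :: 'k mpoly set) m"
    and 0: "subst (phi_map a d b) r = 0"
  shows "r = 0"
proof (rule ccontr)
  assume "r \<noteq> 0"
  have Psi_free: "Poly_Mapping.lookup m (Psi j) = 0" if mj: "m \<in> Poly_Mapping.keys r" for m j
  proof (rule ccontr)
    assume nz: "Poly_Mapping.lookup m (Psi j) \<noteq> 0"
    let ?us = "us_normal (a + d)"
    let ?C = "code ?us"
    \<comment> \<open>The number of \<open>Psi\<close> factors is the top weight of
      \<open>?us\<close>: if some monomial of \<open>r\<close> has such a factor, so does every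
      monomial with maximal code.\<close>
    define pd where "pd = wt (\<lambda>v. case v of Psi j \<Rightarrow> 1 | _ \<Rightarrow> 0)"
    have pd_mono: "pd m \<le> pd n" if "?C m \<le> ?C n" for m n
      using that by (auto simp: code_def us_normal_def pd_def less_pCons_iff le_less)
    have pd_pos: "1 \<le> pd n \<longleftrightarrow> (\<exists>j. Poly_Mapping.lookup n (Psi j) \<noteq> 0)" for n
    proof -
      have "0 \<le> pd n" unfolding pd_def wt_def by (intro sum_nonneg) (auto split: var.split)
      moreover have "pd n = 0 \<longleftrightarrow> (\<forall>v\<in>Poly_Mapping.keys n. v \<notin> range Psi)"
        unfolding pd_def wt_def
        by (subst sum_nonneg_eq_0_iff) (auto simp: in_keys_iff split: var.splits)
      moreover have "\<dots> \<longleftrightarrow> \<not> (\<exists>j. Poly_Mapping.lookup n (Psi j) \<noteq> 0)"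
        by (metis in_keys_iff rangeE rangeI)
      moreover have "1 \<le> pd n \<longleftrightarrow> pd n \<noteq> 0" using calculation(1) by auto
      ultimately show ?thesis by blast
    qed
    obtain m1 where m1: "m1 \<in> Poly_Mapping.keys r" "\<And>n. n \<in> Poly_Mapping.keys r \<Longrightarrow> ?C n \<le> ?C m1"
    proof -
      have "Max (?C ` Poly_Mapping.keys r) \<in> ?C ` Poly_Mapping.keys r"
        using mj by (intro Max_in) auto
      then obtain m1 where "m1 \<in> Poly_Mapping.keys r" "Max (?C ` Poly_Mapping.keys r) = ?C m1" by blast
      moreover from this have "?C n \<le> ?C m1" if "n \<in> Poly_Mapping.keys r" for n
        using that by (metis Max_ge finite_imageI finite_keys imageI)
      ultimately show thesis using that by blast
    qed
    have "1 \<le> pd m1"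
      using pd_mono [OF m1(2) [OF mj]] nz pd_pos [of m] by fastforce
    then obtain i where i: "Poly_Mapping.lookup m1 (Psi i) \<noteq> 0" using pd_pos by blast
    then have i': "Psi i \<in> vars_R b" using r [OF m1(1)] by (auto simp: in_keys_iff subset_iff)
    \<comment> \<open>Separation is available because \<open>m1\<close> contains a
      \<open>Psi\<close>; ties between monomials free of \<open>Psi\<close> can only occur lower
      down.\<close>
    have "?C n < ?C m1" if n: "n \<in> Poly_Mapping.keys r" "n \<noteq> m1" for n
    proof -
      have "?C n \<noteq> ?C m1"
        using b r [OF m1(1)] r [OF n(1)] n(2) i i'
          us_normal_inj_1 [of m0 a m1 d n "a + d" i, where 'k = 'k]
          us_normal_inj_2 [of m0 a m1 d n "a + d" i, where 'k = 'k]
        by auto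
      then show ?thesis using m1(2) [OF n(1)] by simp
    qed
    moreover have lead: "has_lead ws_normal (ev_mon (\<lambda>v. subst normal_coords (phi_map a d b v)) m :: 'k mpoly) (?C m)"
      if "m \<in> Poly_Mapping.keys r" for m
      by (rule has_lead_ev_mon, rule has_lead_normal) (use r [OF that] b(1) d in auto)
    ultimately have "(\<Sum>m\<in>Poly_Mapping.keys r. Const (Poly_Mapping.lookup r m) *
        ev_mon (\<lambda>v. subst normal_coords (phi_map a d b v)) m) \<noteq> 0"
      using m1(1) lead by (intro sum_nonzero_of_lead [where ws = ws_normal and C = ?C and ?m0.0 = m1])
        (auto simp: in_keys_iff)
    moreover have "subst (\<lambda>v. subst normal_coords (phi_map a d b v)) r = 0"
      using 0 by (simp flip: subst_subst)
    ultimately show False by (simp add: subst_eq [of _ r])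
  qed
  have keys: "Poly_Mapping.keys m \<subseteq> vars_R b - range Psi" if "m \<in> Poly_Mapping.keys r" for m
    using r [OF that] Psi_free [OF that] by (auto simp: in_keys_iff)
  have inj: "inj_on (code us_lex) (Poly_Mapping.keys r)"
    using us_lex_inj [OF b, where 'k = 'k] keys r by (intro inj_onI) blast
  obtain m1 where "is_lead us_lex r m1"
    using \<open>r \<noteq> 0\<close> inj by (rule is_lead_exists)
  then have m1: "m1 \<in> Poly_Mapping.keys r"
      "\<And>n. n \<in> Poly_Mapping.keys r \<Longrightarrow> n \<noteq> m1 \<Longrightarrow> code us_lex n < code us_lex m1"
    by (auto simp: is_lead_def in_keys_iff)
  have "has_lead ws_lex (ev_mon (phi_map a d b) m :: 'k mpoly) (code us_lex m)"
    if "m \<in> Poly_Mapping.keys r" for m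
    by (rule has_lead_ev_mon, rule has_lead_lex) (use keys [OF that] in blast)+
  with m1 have "(\<Sum>m\<in>Poly_Mapping.keys r. Const (Poly_Mapping.lookup r m) * ev_mon (phi_map a d b) m) \<noteq> 0"
    by (intro sum_nonzero_of_lead [where ws = ws_lex and C = "code us_lex" and ?m0.0 = m1])
      (auto simp: in_keys_iff)
  then show False using 0 by (simp add: subst_eq)
qed

theorem theorem5p5:
  fixes m0 d a b :: nat
  assumes "0 < m0" and "0 < d"
    and "Gcd {mm m0 d 0, mm m0 d 1, mm m0 d 2, mm m0 d 3} = 1"
    and "minimally_generating (mm m0 d)"
    and "1 \<le> a" and "b \<in> {1, 2}" and "m0 = 3 * a + b"
  shows "is_groebner_basis (gtE m0 d a b) (GB a d b :: 'k::field mpoly set) (E_b a d b)"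
  unfolding is_groebner_basis_def
proof (intro conjI ballI impI)
  let ?ws = "wsE m0 d a b" and ?G = "GB a d b :: 'k mpoly set" and ?\<chi> = "phi_map a d b"
  show GE: "?G \<subseteq> E_b a d b" using assms by (intro GB_subset_E_b)
  fix f :: "'k mpoly" assume f: "f \<in> E_b a d b" "f \<noteq> 0"
  then have f': "subst ?\<chi> f = 0" "\<And>n. n \<in> Poly_Mapping.keys f \<Longrightarrow> Poly_Mapping.keys n \<subseteq> vars_R b"
    by (auto simp: E_b_def R_b_def)
  have "inj_on (code ?ws) (Poly_Mapping.keys f)"
    using assms(6) f'(2) by (intro inj_onI code_wsE_inj [of b]) auto
  with f(2) obtain e where e: "is_lead ?ws f e" by (rule is_lead_exists)
  have "\<exists>g\<in>?G. \<exists>e'. is_lead ?ws g e' \<and> mon_dvd e' e"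
  proof (rule kernel_lead_divisible [where \<chi> = ?\<chi> and V = "vars_R b" and f = f])
    show "subst ?\<chi> g = 0" if "g \<in> ?G" for g
      using that GE by (auto simp: E_b_def)
    show "Poly_Mapping.keys n \<subseteq> vars_R b" if "g \<in> ?G" "n \<in> Poly_Mapping.keys g" for g n
      using that GE by (auto simp: E_b_def R_b_def)
    show "finite {n. Poly_Mapping.keys n \<subseteq> vars_R b \<and> code ?ws n < code ?ws m}"
      if "Poly_Mapping.keys m \<subseteq> vars_R b" for m
      using assms(1) that by (rule finite_wsE_smaller)
    show "r = 0" if "\<And>n. n \<in> Poly_Mapping.keys r \<Longrightarrow> Poly_Mapping.keys n \<subseteq> vars_R b \<and> standard ?ws ?G n"
      "subst ?\<chi> r = 0" for r :: "'k mpoly"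
      using standard_independent [OF assms(6,7,5,2) that] .
  qed (use f' e in auto)
  then obtain g e' where g: "g \<in> ?G" "is_lead ?ws g e'" "mon_dvd e' e" by blast
  then have "g \<noteq> 0" by (auto simp: is_lead_def)
  then show "\<exists>g\<in>?G. g \<noteq> 0 \<and> mon_dvd (lead_mon (gtE m0 d a b) g) (lead_mon (gtE m0 d a b) f)"
    using g lead_mon_eq [OF e] lead_mon_eq [OF g(2)] by auto
qed

end
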